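(* Let $\mathbb{F}$ be an algebraically closed field of arbitrary characteristic and let $m$ be a positive integer. (i) The following is a separating system of $\mathcal{O}((\mathbb{F}^{2\times 2})^m)^{SL_2\times SL_2}$: \[\mathcal{S}_m:=\{\det(x_k),\ \langle x_l\vert x_r\rangle,\ \xi_2(x_{k_1},x_{k_2},x_{k_3},x_{k_4})\mid k=1,\dots,m;\ 1\le l<r\le m;\ 1\le k_1<\cdots<k_4\le m\}.\] (ii) The separating system $\mathcal{S}_m$ is irredundant.
   Context: The group $SL_2\times SL_2$ (two copies of the special linear group over $\mathbb{F}$) acts on $M=(\mathbb{F}^{2\times 2})^m$ by $(g,h)\cdot(A_1,\dots,A_m)=(gA_1h^{-1},\dots,gA_mh^{-1})$. $\mathcal{O}(M)=\mathbb{F}[x_{ijk}\mid 1\le i,j\le 2,\ 1\le k\le m]$, where $x_{ijk}$ is the function sending $(A_1,\dots,A_m)$ to the $(i,j)$-entry of $A_k$, and $\mathcal{O}(M)^{SL_2\times SL_2}$ is the subalgebra of polynomial functions constant on $SL_2\times SL_2$-orbits. $x_k=(x_{ijk})_{i,j=1}^2$ is the $k$-th generic matrix. $\langle x_k\vert x_l\rangle$ is the coefficient of $zw$ in $\det(zx_k+wx_l)$ ($z,w$ commuting variables), i.e. $\langle x_k\vert x_l\rangle=x_{11k}x_{22l}+x_{11l}x_{22k}-x_{12k}x_{21l}-x_{12l}x_{21k}$. For $2\times 2$ matrices $y_1,y_2,y_3,y_4$ over a commutative ring $A$, $\xi_2(y_1,y_2,y_3,y_4)\in A$ is the coefficient of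 $z_1z_2w_1w_2$ in the $4\times 4$ determinant $\det\begin{pmatrix} z_1y_1 & w_1y_3\\ w_2y_4 & z_2y_2\end{pmatrix}$ (written in $2\times 2$ blocks) over $A[z_1,z_2,w_1,w_2]$. A subset $S\subseteq \mathcal{O}(M)^{SL_2\times SL_2}$ is called separating if for any $A,B\in M$: whenever there exists $f\in\mathcal{O}(M)^{SL_2\times SL_2}$ with $f(A)\neq f(B)$, there exists $h\in S$ with $h(A)\ne h(B)$. A separating system is irredundant if omitting any one of its elements leaves a set that is not separating. *)

theory Defs
  imports
    "HOL-Analysis.Analysis"
    "HOL-Library.Function_Algebras"
    "HOL-Library.Poly_Mapping"
    "HOL-Computational_Algebra.Polynomial"
begin

text \<open>
  Polynomials over \<open>'r\<close> in commuting variables indexed by \<^typ>\<open>nat\<close>, as the monoid algebra of the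
  monoid of finitely supported exponent vectors.
\<close>

type_synonym 'r mpoly = "(nat \<Rightarrow>\<^sub>0 nat) \<Rightarrow>\<^sub>0 'r"

definition mconst :: "'r \<Rightarrow> 'r::comm_ring_1 mpoly" where
  "mconst c = Poly_Mapping.single 0 c"

definition mvar :: "nat \<Rightarrow> 'r::comm_ring_1 mpoly" where
  "mvar i = Poly_Mapping.single (Poly_Mapping.single i 1) 1"

definition scaled_mat :: "'r mpoly \<Rightarrow> 'r^2^2 \<Rightarrow> 'r::comm_ring_1 mpoly^2^2" where
  "scaled_mat t y = (\<chi> i j. t * mconst (y $ i $ j))"

text \<open>Here \<open>z\<close> and \<open>w\<close> are the variables with index 0 and 1.\<close>

definition bracket :: "'r^2^2 \<Rightarrow> 'r^2^2 \<Rightarrow> 'r::comm_ring_1" where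
  "bracket x y =
     Poly_Mapping.lookup (det (scaled_mat (mvar 0) x + scaled_mat (mvar 1) y))
       (Poly_Mapping.single 0 1 + Poly_Mapping.single 1 1)"

definition block_mat :: "'r^2^2 \<Rightarrow> 'r^2^2 \<Rightarrow> 'r^2^2 \<Rightarrow> 'r^2^2 \<Rightarrow> 'r^(2+2)^(2+2)" where
  "block_mat a b c d =
     (\<chi> i j. case i of
         Inl p \<Rightarrow> (case j of Inl q \<Rightarrow> a $ p $ q | Inr q \<Rightarrow> b $ p $ q)
       | Inr p \<Rightarrow> (case j of Inl q \<Rightarrow> c $ p $ q | Inr q \<Rightarrow> d $ p $ q))"

text \<open>Here \<open>z\<^sub>1, z\<^sub>2, w\<^sub>1, w\<^sub>2\<close> are the variables with index 0, 1, 2, 3.\<close>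

definition xi2 :: "'r^2^2 \<Rightarrow> 'r^2^2 \<Rightarrow> 'r^2^2 \<Rightarrow> 'r^2^2 \<Rightarrow> 'r::comm_ring_1" where
  "xi2 y1 y2 y3 y4 =
     Poly_Mapping.lookup
       (det (block_mat (scaled_mat (mvar 0) y1) (scaled_mat (mvar 2) y3)
                       (scaled_mat (mvar 3) y4) (scaled_mat (mvar 1) y2)))
       (Poly_Mapping.single 0 1 + Poly_Mapping.single 1 1 +
        Poly_Mapping.single 2 1 + Poly_Mapping.single 3 1)"

text \<open>
  A point of \<open>M = (F\<^sup>2\<^sup>\<times>\<^sup>2)\<^sup>m\<close> is a family indexed by \<open>{1..m}\<close>, extended by \<^const>\<open>undefined\<close>.
\<close>

definition mat_tuples :: "nat \<Rightarrow> (nat \<Rightarrow> 'a^2^2) set" where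
  "mat_tuples m = {1..m} \<rightarrow>\<^sub>E UNIV"

definition SL2 :: "('a::field^2^2) set" where
  "SL2 = {g. det g = 1}"

definition act :: "nat \<Rightarrow> 'a::field^2^2 \<Rightarrow> 'a^2^2 \<Rightarrow> (nat \<Rightarrow> 'a^2^2) \<Rightarrow> (nat \<Rightarrow> 'a^2^2)" where
  "act m g h A = (\<lambda>k\<in>{1..m}. g ** A k ** matrix_inv h)"

text \<open>
  The ring structure on functions is the pointwise one of \<^theory>\<open>HOL-Library.Function_Algebras\<close>.
  Polynomial functions are total functions on \<^typ>\<open>nat \<Rightarrow> 'a^2^2\<close> that depend only on the
  components with index in \<open>{1..m}\<close>, so they are determined by their values on \<open>mat_tuples m\<close>.
\<close>

definition generic_mat :: "nat \<Rightarrow> ((nat \<Rightarrow> 'a^2^2) \<Rightarrow> 'a)^2^2" where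
  "generic_mat k = (\<chi> i j. (\<lambda>A. A k $ i $ j))"

inductive_set coord_ring :: "nat \<Rightarrow> ((nat \<Rightarrow> 'a::field^2^2) \<Rightarrow> 'a) set" for m :: nat where
  const: "(\<lambda>_. c) \<in> coord_ring m"
| coord: "k \<in> {1..m} \<Longrightarrow> generic_mat k $ i $ j \<in> coord_ring m"
| add: "p \<in> coord_ring m \<Longrightarrow> q \<in> coord_ring m \<Longrightarrow> p + q \<in> coord_ring m"
| mult: "p \<in> coord_ring m \<Longrightarrow> q \<in> coord_ring m \<Longrightarrow> p * q \<in> coord_ring m"

definition invariant_ring :: "nat \<Rightarrow> ((nat \<Rightarrow> 'a::field^2^2) \<Rightarrow> 'a) set" where
  "invariant_ring m =
     {f \<in> coord_ring m. \<forall>g\<in>SL2. \<forall>h\<in>SL2. \<forall>A\<in>mat_tuples m. f (act m g h A) = f A}"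

definition separating :: "nat \<Rightarrow> ((nat \<Rightarrow> 'a::field^2^2) \<Rightarrow> 'a) set \<Rightarrow> bool" where
  "separating m S \<longleftrightarrow> S \<subseteq> invariant_ring m \<and>
     (\<forall>A\<in>mat_tuples m. \<forall>B\<in>mat_tuples m.
        (\<exists>f\<in>invariant_ring m. f A \<noteq> f B) \<longrightarrow> (\<exists>h\<in>S. h A \<noteq> h B))"

definition irredundant :: "nat \<Rightarrow> ((nat \<Rightarrow> 'a::field^2^2) \<Rightarrow> 'a) set \<Rightarrow> bool" where
  "irredundant m S \<longleftrightarrow> (\<forall>s\<in>S. \<not> separating m (S - {s}))"

definition S_system :: "nat \<Rightarrow> ((nat \<Rightarrow> 'a::field^2^2) \<Rightarrow> 'a) set" where
  "S_system m =
     {det (generic_mat k) | k. 1 \<le> k \<and> k \<le> m} \<union>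
     {bracket (generic_mat l) (generic_mat r) | l r. 1 \<le> l \<and> l < r \<and> r \<le> m} \<union>
     {xi2 (generic_mat k1) (generic_mat k2) (generic_mat k3) (generic_mat k4) | k1 k2 k3 k4.
        1 \<le> k1 \<and> k1 < k2 \<and> k2 < k3 \<and> k3 < k4 \<and> k4 \<le> m}"

end

theory Submission
  imports Defs
begin

text \<open>
  The space of \<open>2 \<times> 2\<close> matrices with the determinant is a four-dimensional quadratic space whose polar
  form is \<^const>\<open>bracket\<close>, and \<open>SL\<^sub>2 \<times> SL\<^sub>2\<close> acts on it by proper isometries. Writing \<open>a\<^sup>*\<close> for the
  adjugate, so that \<open>a a\<^sup>* = det a\<close>, the trace of \<open>a b\<^sup>* c d\<^sup>*\<close> is invariant, and \<^const>\<open>xi2\<close> is this trace up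
  to sign and order of the arguments (\<open>xi2_eq_clifford_trace\<close>). Polarising \<open>a a\<^sup>* = det a\<close> gives
  Clifford relations: exchanging two neighbours changes the sign of the trace up to products of
  brackets, and on two equal neighbours the trace is a product of a determinant and a bracket.
  Therefore the elements of the system, where \<^const>\<open>xi2\<close> occurs only at increasing indices, determine
  these traces at all quadruples of indices (\<open>data_agree_if_S_system_agrees\<close>).

  Let two tuples \<open>A\<close> and \<open>B\<close> have the same values on the system. Then corresponding linear combinations
  of the \<open>A\<^sub>k\<close> and of the \<open>B\<^sub>k\<close> have the same determinants and brackets. Since invariants are polynomial,
  they take the same value at the limit of a one-parameter family inside an orbit as on the orbit
  itself; so it suffices to move \<open>A\<close> and \<open>B\<close> to a common tuple by group elements and such limits. The
  span of the \<open>A\<^sub>k\<close> falls into one of three cases, and the span of the \<open>B\<^sub>k\<close> into the same one.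

  \<^item> The span contains a hyperbolic pair, i.e. two singular matrices with bracket 1. The group moves the
    pair to the matrix units \<open>E\<^sub>1\<^sub>1\<close>, \<open>E\<^sub>2\<^sub>2\<close>. Then the brackets with the pair are the diagonal entries, and
    the traces of \<open>A\<^sub>i E\<^sub>1\<^sub>1\<^sup>* A\<^sub>j E\<^sub>2\<^sub>2\<^sup>*\<close> are the products of the upper right entry of \<open>A\<^sub>i\<close> and the lower left
    entry of \<open>A\<^sub>j\<close>. If some product is nonzero, the products determine the off-diagonal entries up to
    the torus that fixes the pair; if all vanish, the tuple is triangular and degenerates to its diagonal
    part (\<open>inseparable_if_hyperbolic\<close>).
  \<^item> The determinant vanishes on the span. Then the tuple degenerates to 0
    (\<open>inseparable_totally_singular\<close>).
  \<^item> Otherwise there is a combination \<open>X\<close> of determinant 1. For each \<open>k\<close>, the two roots \<open>c\<close> of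
    \<open>det (A\<^sub>k - c X)\<close> coincide, because two different roots would give singular matrices with nonzero
    bracket. Hence \<open>A\<^sub>k = c\<^sub>k X + U\<^sub>k\<close> with the \<open>U\<^sub>k\<close> spanning a totally singular space orthogonal to \<open>X\<close>,
    and the tuple degenerates to the scalar matrices \<open>c\<^sub>k\<close> (\<open>inseparable_scalar_part\<close>).

  This division is independent of the characteristic: nowhere is the quadratic form recovered
  from its polar form.

  For irredundance, each element of the system has a pair of tuples on which it differs while all others
  agree: a single nonzero component for a determinant, a hyperbolic pair for a bracket, and, for
  \<^const>\<open>xi2\<close>, the four matrix units together with their transposes, since transposition is an
  improper isometry (\<open>S_system_irredundant\<close>).
\<close>

section \<open>Matrices of size two and the Clifford trace\<close>

lemma UNIV_2_plus_2: "(UNIV :: (2+2) set) = {Inl 1, Inl 2, Inr 1, Inr 2}"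
  by (auto simp: UNIV_Plus_UNIV[symmetric] UNIV_2 Plus_def)

lemma det_block_mat:
  fixes a b c d :: "'r::comm_ring_1^2^2"
  shows "det (block_mat a b c d) =
     a$1$1 * a$2$2 * d$1$1 * d$2$2 - a$1$1 * a$2$2 * d$1$2 * d$2$1
      - a$1$1 * b$2$1 * c$1$2 * d$2$2 + a$1$1 * b$2$1 * d$1$2 * c$2$2
      + a$1$1 * b$2$2 * c$1$2 * d$2$1 - a$1$1 * b$2$2 * d$1$1 * c$2$2
      - a$1$2 * a$2$1 * d$1$1 * d$2$2 + a$1$2 * a$2$1 * d$1$2 * d$2$1
      + a$1$2 * b$2$1 * c$1$1 * d$2$2 - a$1$2 * b$2$1 * d$1$2 * c$2$1
      - a$1$2 * b$2$2 * c$1$1 * d$2$1 + a$1$2 * b$2$2 * d$1$1 * c$2$1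
      + b$1$1 * a$2$1 * c$1$2 * d$2$2 - b$1$1 * a$2$1 * d$1$2 * c$2$2
      - b$1$1 * a$2$2 * c$1$1 * d$2$2 + b$1$1 * a$2$2 * d$1$2 * c$2$1
      + b$1$1 * b$2$2 * c$1$1 * c$2$2 - b$1$1 * b$2$2 * c$1$2 * c$2$1
      - b$1$2 * a$2$1 * c$1$2 * d$2$1 + b$1$2 * a$2$1 * d$1$1 * c$2$2
      + b$1$2 * a$2$2 * c$1$1 * d$2$1 - b$1$2 * a$2$2 * d$1$1 * c$2$1
      - b$1$2 * b$2$1 * c$1$1 * c$2$2 + b$1$2 * b$2$1 * c$1$2 * c$2$1"
proof -
  have f1: "finite {Inl 2::2+2, Inr 1, Inr 2}" "(Inl 1::2+2) \<notin> {Inl 2, Inr 1, Inr 2}" by auto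
  have f2: "finite {Inr 1::2+2, Inr 2}" "(Inl 2::2+2) \<notin> {Inr 1, Inr 2}" by auto
  have f3: "finite {Inr 2::2+2}" "(Inr 1::2+2) \<notin> {Inr 2}" by auto
  show ?thesis
    unfolding det_def UNIV_2_plus_2
    unfolding sum_over_permutations_insert[OF f1]
    unfolding sum_over_permutations_insert[OF f2]
    unfolding sum_over_permutations_insert[OF f3]
    unfolding permutes_sing
    by (simp add: sign_compose sign_swap_id permutation_swap_id permutation_compose sign_id
        transpose_def block_mat_def algebra_simps)
qed

definition mat2 :: "'r \<Rightarrow> 'r \<Rightarrow> 'r \<Rightarrow> 'r \<Rightarrow> 'r::comm_ring_1^2^2" where
  "mat2 a b c d = vector [vector [a, b], vector [c, d]]"

lemma mat2_nth [simp]: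
  "mat2 a b c d $ 1 $ 1 = a" "mat2 a b c d $ 1 $ 2 = b"
  "mat2 a b c d $ 2 $ 1 = c" "mat2 a b c d $ 2 $ 2 = d"
  by (simp_all add: mat2_def)

lemma mat2_eq_iff:
  "A = B \<longleftrightarrow> A$1$1 = B$1$1 \<and> A$1$2 = B$1$2 \<and> A$2$1 = B$2$1 \<and> A$2$2 = B$2$2"
  for A B :: "'r^2^2"
  by (auto simp: vec_eq_iff forall_2)

lemma mat2_mult_nth: "(A ** B) $ i $ j = A$i$1 * B$1$j + A$i$2 * B$2$j"
  for A B :: "'r::comm_ring_1^2^2"
  by (simp add: matrix_matrix_mult_def sum_2)

lemma mat_1_nth [simp]:
  "(mat 1 :: 'r::comm_ring_1^2^2) $ 1 $ 1 = 1" "(mat 1 :: 'r^2^2) $ 1 $ 2 = 0"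
  "(mat 1 :: 'r^2^2) $ 2 $ 1 = 0" "(mat 1 :: 'r^2^2) $ 2 $ 2 = 1"
  by (simp_all add: mat_def)

text \<open>
  The canonical involution of the matrix algebra, whose norm form is the determinant.
\<close>

definition adj2 :: "'r::comm_ring_1^2^2 \<Rightarrow> 'r^2^2" where
  "adj2 A = mat2 (A$2$2) (- A$1$2) (- A$2$1) (A$1$1)"

definition smult_mat :: "'r \<Rightarrow> 'r^2^2 \<Rightarrow> 'r::comm_ring_1^2^2" where
  "smult_mat c A = (\<chi> i j. c * A$i$j)"

lemma smult_mat_nth [simp]: "smult_mat c A $ i $ j = c * A$i$j"
  by (simp add: smult_mat_def)

lemma det_adj2 [simp]: "det (adj2 A) = det A"
  by (simp add: det_2 adj2_def algebra_simps)

lemma adj2_adj2 [simp]: "adj2 (adj2 A) = A"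
  by (simp add: adj2_def mat2_eq_iff)

lemma adj2_mult: "adj2 (A ** B) = adj2 B ** adj2 A"
  by (simp add: adj2_def mat2_eq_iff mat2_mult_nth algebra_simps)

lemma mult_adj2: "det A = 1 \<Longrightarrow> A ** adj2 A = mat 1" "det A = 1 \<Longrightarrow> adj2 A ** A = mat 1"
  by (auto simp: adj2_def mat2_eq_iff mat2_mult_nth det_2 algebra_simps)

lemma matrix_inv_eq_adj2:
  fixes h :: "'a::field^2^2"
  assumes "det h = 1"
  shows "matrix_inv h = adj2 h"
proof -
  have "h ** matrix_inv h = mat 1"
    unfolding matrix_inv_def using mult_adj2[OF assms] by (metis (mono_tags, lifting) someI)
  then have "adj2 h ** h ** matrix_inv h = adj2 h"
    by (simp flip: matrix_mul_assoc)
  then show ?thesis by (simp add: mult_adj2[OF assms])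
qed

text \<open>
  Alternating the factors with and without adjugate makes the action \<open>a \<mapsto> g a h\<close> with
  \<open>det g = det h = 1\<close> telescope to a conjugation by \<open>g\<close>, so that the trace is invariant.
\<close>

definition clifford_trace ::
    "'r^2^2 \<Rightarrow> 'r^2^2 \<Rightarrow> 'r^2^2 \<Rightarrow> 'r^2^2 \<Rightarrow> 'r::comm_ring_1" where
  "clifford_trace a b c d = trace (a ** adj2 b ** c ** adj2 d)"

lemma scaled_mat_nth:
  "scaled_mat (mvar i) y $ p $ q = Poly_Mapping.single (Poly_Mapping.single i 1) (y $ p $ q)"
  by (simp add: scaled_mat_def mvar_def mconst_def mult_single)

lemma bracket_eq:
  "bracket x y = x$1$1 * y$2$2 + y$1$1 * x$2$2 - x$1$2 * y$2$1 - y$1$2 * x$2$1"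
proof -
  let ?e = "\<lambda>i. Poly_Mapping.single i 1 :: nat \<Rightarrow>\<^sub>0 nat"
  have "Poly_Mapping.lookup (?e 0 + ?e 0) 0 \<noteq> Poly_Mapping.lookup (?e 0 + ?e 1) 0"
    "Poly_Mapping.lookup (?e 1 + ?e 1) 0 \<noteq> Poly_Mapping.lookup (?e 0 + ?e 1) 0"
    by (simp_all add: lookup_add lookup_single)
  then have "?e 0 + ?e 0 \<noteq> ?e 0 + ?e 1" "?e 1 + ?e 1 \<noteq> ?e 0 + ?e 1" by auto
  then show ?thesis
    by (simp add: bracket_def det_2 scaled_mat_nth mult_single distrib_left distrib_right
        lookup_add lookup_minus lookup_single when_def add.commute[of "?e 1" "?e 0"])
      (simp add: algebra_simps)
qed

text \<open>
  Each of the 24 products in the determinant is a monomial, with exponent \<open>z\<^sub>1\<^sup>2z\<^sub>2\<^sup>2\<close>, \<open>w\<^sub>1\<^sup>2w\<^sub>2\<^sup>2\<close> or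
  \<open>z\<^sub>1z\<^sub>2w\<^sub>1w\<^sub>2\<close>. The last kind takes one entry from each block, in complementary rows and columns, which is
  how the terms of the trace of \<open>y\<^sub>1 y\<^sub>4\<^sup>* y\<^sub>2 y\<^sub>3\<^sup>*\<close> arise.
\<close>

lemma xi2_eq_clifford_trace: "xi2 y1 y2 y3 y4 = - clifford_trace y1 y4 y2 y3"
proof -
  define e :: "nat \<Rightarrow> (nat \<Rightarrow>\<^sub>0 nat)" where "e = (\<lambda>i. Poly_Mapping.single i 1)"
  have entry: "scaled_mat (mvar i) y $ p $ q = Poly_Mapping.single (e i) (y $ p $ q)"
    for i p q and y :: "'a^2^2"
    by (simp add: e_def scaled_mat_def mvar_def mconst_def mult_single)
  let ?t = "e 0 + (e 1 + (e 2 + e 3))"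
  have "Poly_Mapping.lookup (e 0 + (e 0 + (e 1 + e 1))) 0 \<noteq> Poly_Mapping.lookup ?t 0"
    "Poly_Mapping.lookup (e 2 + (e 2 + (e 3 + e 3))) 0 \<noteq> Poly_Mapping.lookup ?t 0"
    by (simp_all add: e_def lookup_add lookup_single)
  then have ne: "e 0 + (e 0 + (e 1 + e 1)) \<noteq> ?t" "e 2 + (e 2 + (e 3 + e 3)) \<noteq> ?t" by auto
  \<comment> \<open>Oriented by the index, these equations sort every exponent into one of the three normal forms.\<close>
  have sorted: "e i + e j + e k + e l = e i + (e j + (e k + e l))"
    "j < i \<Longrightarrow> e i + e j = e j + e i" "j < i \<Longrightarrow> e i + (e j + z) = e j + (e i + z)" for i j k l z
    by (simp_all add: ac_simps)
  have coeff: "Poly_Mapping.lookup (Poly_Mapping.single (e 0 + (e 0 + (e 1 + e 1))) r) ?t = 0"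
    "Poly_Mapping.lookup (Poly_Mapping.single (e 2 + (e 2 + (e 3 + e 3))) r) ?t = 0"
    "Poly_Mapping.lookup (Poly_Mapping.single ?t r) ?t = r" for r :: 'a
    using ne by (simp_all only: lookup_single when_def if_False if_True refl)
  have t: "Poly_Mapping.single 0 1 + Poly_Mapping.single 1 1 + Poly_Mapping.single 2 1 +
      Poly_Mapping.single 3 1 = ?t"
    by (simp add: e_def add.assoc)
  have less: "(0::nat) < 1" "(0::nat) < 2" "(0::nat) < 3" "(1::nat) < 2" "(1::nat) < 3" "(2::nat) < 3"
    by simp_all
  show ?thesis
    unfolding xi2_def det_block_mat entry t
    by (simp only: mult_single add.assoc sorted(2,3) less lookup_add lookup_minus coeff)
      (simp add: clifford_trace_def trace_def sum_2 mat2_mult_nth adj2_def algebra_simps)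
qed

lemmas clifford_trace_expand = clifford_trace_def trace_def sum_2 mat2_mult_nth adj2_def

lemma bracket_commute: "bracket a b = bracket b a"
  by (simp add: bracket_eq algebra_simps)

lemma bracket_self: "bracket a a = 2 * det a"
  by (simp add: bracket_eq det_2 algebra_simps)

text \<open>
  Polarising \<open>a a\<^sup>* = det a\<close> gives \<open>a b\<^sup>* + b a\<^sup>* = \<langle>a|b\<rangle>\<close>, and likewise \<open>a\<^sup>* b + b\<^sup>* a = \<langle>a|b\<rangle>\<close>. Inserted at two
  neighbours this leaves the trace of the other two, which is again a bracket.
\<close>

lemma clifford_trace_swap:
  "clifford_trace b a c d = bracket a b * bracket c d - clifford_trace a b c d"
  "clifford_trace a c b d = bracket b c * bracket a d - clifford_trace a b c d"
  "clifford_trace a b d c = bracket c d * bracket a b - clifford_trace a b c d"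
  by (simp_all add: clifford_trace_expand bracket_eq algebra_simps)

lemma clifford_trace_repeat:
  "clifford_trace a a c d = det a * bracket c d"
  "clifford_trace a b b d = det b * bracket a d"
  "clifford_trace a b c c = det c * bracket a b"
  by (simp_all add: clifford_trace_expand bracket_eq det_2 algebra_simps)

lemma det_invariant: "det g = 1 \<Longrightarrow> det h = 1 \<Longrightarrow> det (g ** A ** h) = det A"
  for g h A :: "'r::comm_ring_1^2^2"
  by (simp add: det_mul)

text \<open>
  The bracket is the polar form of the determinant.
\<close>

lemma det_add2: "det (A + B) = det A + bracket A B + det B"
  for A B :: "'r::comm_ring_1^2^2"
  by (simp add: det_2 bracket_eq algebra_simps)

lemma bracket_invariant:
  fixes g h a b :: "'r::comm_ring_1^2^2"
  assumes "det g = 1" "det h = 1"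
  shows "bracket (g ** a ** h) (g ** b ** h) = bracket a b"
proof -
  \<comment> \<open>The polar form inherits its invariance from the determinant.\<close>
  have "bracket x y = det (x + y) - det x - det y" for x y :: "'r^2^2"
    by (simp add: det_add2)
  moreover have "g ** a ** h + g ** b ** h = g ** (a + b) ** h"
    by (simp add: mat2_eq_iff mat2_mult_nth algebra_simps)
  ultimately show ?thesis
    using assms by (simp add: det_mul)
qed

lemma clifford_trace_invariant:
  fixes g h a b c d :: "'r::comm_ring_1^2^2"
  assumes "det g = 1" "det h = 1"
  shows "clifford_trace (g ** a ** h) (g ** b ** h) (g ** c ** h) (g ** d ** h) =
    clifford_trace a b c d"
proof -
  have cancel: "X ** h ** (adj2 h ** Y) = X ** Y" "X ** adj2 g ** (g ** Y) = X ** Y" for X Y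
    by (metis matrix_mul_assoc matrix_mul_rid mult_adj2 assms)+
  have pair: "(g ** x ** h) ** adj2 (g ** y ** h) = g ** (x ** adj2 y) ** adj2 g" for x y
    using cancel(1)[of "g ** x" "adj2 y ** adj2 g"] by (simp add: adj2_mult matrix_mul_assoc)
  have "(g ** a ** h) ** adj2 (g ** b ** h) ** (g ** c ** h) ** adj2 (g ** d ** h) =
      g ** (a ** adj2 b) ** adj2 g ** (g ** (c ** adj2 d) ** adj2 g)"
    unfolding pair[symmetric] by (simp add: matrix_mul_assoc)
  also have "\<dots> = g ** (a ** adj2 b ** c ** adj2 d) ** adj2 g"
    using cancel(2)[of "g ** (a ** adj2 b)" "c ** adj2 d ** adj2 g"] by (simp add: matrix_mul_assoc)
  finally show ?thesis
    by (simp add: clifford_trace_def)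
      (metis assms(1) matrix_mul_assoc matrix_mul_lid mult_adj2(2) trace_mul_sym)
qed

section \<open>Invariants and one-parameter degenerations\<close>

lemma coord_ring_uminus: "f \<in> coord_ring m \<Longrightarrow> - f \<in> coord_ring m"
proof -
  assume "f \<in> coord_ring m"
  then have "(\<lambda>_. - 1) * f \<in> coord_ring m" by (intro coord_ring.intros)
  moreover have "(\<lambda>_. - 1) * f = - f" by (simp add: fun_eq_iff)
  ultimately show ?thesis by simp
qed

lemma coord_ring_diff: "f \<in> coord_ring m \<Longrightarrow> g \<in> coord_ring m \<Longrightarrow> f - g \<in> coord_ring m"
  using coord_ring.add[of f m "- g"] coord_ring_uminus by fastforce

lemmas coord_ring_closed =
  coord_ring.add coord_ring.mult coord_ring_uminus coord_ring_diff

lemma coord_ring_cong: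
  assumes "f \<in> coord_ring m" "\<And>k. k \<in> {1..m} \<Longrightarrow> A k = B k"
  shows "f A = f B"
  using assms by induction (auto simp: generic_mat_def)

lemma generic_values:
  "det (generic_mat k) A = det (A k)"
  "bracket (generic_mat k) (generic_mat l) A = bracket (A k) (A l)"
  "clifford_trace (generic_mat i) (generic_mat j) (generic_mat k) (generic_mat l) A =
    clifford_trace (A i) (A j) (A k) (A l)"
  "xi2 (generic_mat i) (generic_mat j) (generic_mat k) (generic_mat l) A =
    xi2 (A i) (A j) (A k) (A l)"
  by (simp_all add: det_2 bracket_eq xi2_eq_clifford_trace clifford_trace_expand generic_mat_def)

lemma generic_mat_in_coord_ring:
  assumes "i \<in> {1..m}" "j \<in> {1..m}" "k \<in> {1..m}" "l \<in> {1..m}"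
  shows "det (generic_mat i) \<in> coord_ring m"
    "bracket (generic_mat i) (generic_mat j) \<in> coord_ring m"
    "clifford_trace (generic_mat i) (generic_mat j) (generic_mat k) (generic_mat l) \<in> coord_ring m"
proof -
  note gen = assms[THEN coord_ring.coord]
  show "det (generic_mat i) \<in> coord_ring m"
    unfolding det_2 by (intro coord_ring_closed gen)
  show "bracket (generic_mat i) (generic_mat j) \<in> coord_ring m"
    unfolding bracket_eq by (intro coord_ring_closed gen)
  show "clifford_trace (generic_mat i) (generic_mat j) (generic_mat k) (generic_mat l) \<in> coord_ring m"
    unfolding clifford_trace_expand mat2_nth by (intro coord_ring_closed gen)
qed

lemma invariant_ringI:
  assumes "f \<in> coord_ring m"
    and "\<And>g h A. det g = 1 \<Longrightarrow> det h = 1 \<Longrightarrow> f (\<lambda>k. g ** A k ** h) = f A"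
  shows "f \<in> invariant_ring m"
proof -
  have "f (act m g h A) = f A" if "g \<in> SL2" "h \<in> SL2" for g h A
  proof -
    have "f (act m g h A) = f (\<lambda>k. g ** A k ** adj2 h)"
      by (rule coord_ring_cong[OF assms(1)]) (use that in \<open>simp add: act_def SL2_def matrix_inv_eq_adj2\<close>)
    then show ?thesis using assms(2) that by (simp add: SL2_def)
  qed
  then show ?thesis using assms(1) by (simp add: invariant_ring_def)
qed

lemma generic_mat_in_invariant_ring:
  fixes m :: nat
  assumes ijkl: "i \<in> {1..m}" "j \<in> {1..m}" "k \<in> {1..m}" "l \<in> {1..m}"
  shows "det (generic_mat i :: ((nat \<Rightarrow> 'a::field^2^2) \<Rightarrow> 'a)^2^2) \<in> invariant_ring m"
    "bracket (generic_mat i :: ((nat \<Rightarrow> 'a^2^2) \<Rightarrow> 'a)^2^2) (generic_mat j) \<in> invariant_ring m"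
    "clifford_trace (generic_mat i :: ((nat \<Rightarrow> 'a^2^2) \<Rightarrow> 'a)^2^2)
      (generic_mat j) (generic_mat k) (generic_mat l) \<in> invariant_ring m"
    "xi2 (generic_mat i :: ((nat \<Rightarrow> 'a^2^2) \<Rightarrow> 'a)^2^2)
      (generic_mat j) (generic_mat k) (generic_mat l) \<in> invariant_ring m"
proof -
  show "det (generic_mat i :: ((nat \<Rightarrow> 'a::field^2^2) \<Rightarrow> 'a)^2^2) \<in> invariant_ring m"
    by (rule invariant_ringI)
      (simp_all only: generic_mat_in_coord_ring[OF ijkl] generic_values det_invariant)
  show "bracket (generic_mat i :: ((nat \<Rightarrow> 'a^2^2) \<Rightarrow> 'a)^2^2) (generic_mat j) \<in> invariant_ring m"
    by (rule invariant_ringI)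
      (simp_all only: generic_mat_in_coord_ring[OF ijkl] generic_values bracket_invariant)
  show "clifford_trace (generic_mat i :: ((nat \<Rightarrow> 'a^2^2) \<Rightarrow> 'a)^2^2)
      (generic_mat j) (generic_mat k) (generic_mat l) \<in> invariant_ring m"
    by (rule invariant_ringI)
      (simp_all only: generic_mat_in_coord_ring[OF ijkl] generic_values clifford_trace_invariant)
  show "xi2 (generic_mat i :: ((nat \<Rightarrow> 'a^2^2) \<Rightarrow> 'a)^2^2)
      (generic_mat j) (generic_mat k) (generic_mat l) \<in> invariant_ring m"
    unfolding xi2_eq_clifford_trace
    by (rule invariant_ringI)
      (simp_all only: coord_ring_uminus generic_mat_in_coord_ring(3)[OF ijkl(1,4,2,3)] generic_values
        clifford_trace_invariant uminus_apply)
qed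

text \<open>
  No invariant distinguishes the two tuples. Since invariants depend only on the components with index
  in \<open>{1..m}\<close>, tuples are left arbitrary outside that range.
\<close>

definition inseparable :: "nat \<Rightarrow> (nat \<Rightarrow> 'a::field^2^2) \<Rightarrow> (nat \<Rightarrow> 'a^2^2) \<Rightarrow> bool" where
  "inseparable m A B \<longleftrightarrow> (\<forall>f\<in>invariant_ring m. f A = f B)"

lemma inseparable_sym: "inseparable m A B \<Longrightarrow> inseparable m B A"
  unfolding inseparable_def by metis

lemma inseparable_trans [trans]:
  "inseparable m A B \<Longrightarrow> inseparable m B C \<Longrightarrow> inseparable m A C"
  unfolding inseparable_def by metis

lemma inseparable_cong: "(\<And>k. k \<in> {1..m} \<Longrightarrow> A k = B k) \<Longrightarrow> inseparable m A B"
  unfolding inseparable_def invariant_ring_def using coord_ring_cong[of _ m A B] by blast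

lemma inseparable_act:
  assumes "det g = 1" "det h = 1" and "\<And>k. k \<in> {1..m} \<Longrightarrow> B k = g ** A k ** h"
  shows "inseparable m A B"
  unfolding inseparable_def
proof
  fix f :: "(nat \<Rightarrow> 'a^2^2) \<Rightarrow> 'a" assume f: "f \<in> invariant_ring m"
  then have cong: "f X = f Y" if "\<And>k. k \<in> {1..m} \<Longrightarrow> X k = Y k" for X Y
    using coord_ring_cong[of f m X Y] that by (simp add: invariant_ring_def)
  have "f A = f (restrict A {1..m})" by (rule cong) simp
  also have "\<dots> = f (act m g (adj2 h) (restrict A {1..m}))"
    using f assms(1,2) by (simp add: invariant_ring_def SL2_def mat_tuples_def)
  also have "\<dots> = f B"
    by (rule cong) (simp add: act_def assms matrix_inv_eq_adj2)
  finally show "f A = f B" .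
qed

text \<open>
  Over a finite field the product of all \<open>X - a\<close>, plus 1, has no root. Infinity of the field is
  what lets a polynomial that is constant away from 0 be evaluated at 0.
\<close>

lemma infinite_UNIV_alg_closed: "infinite (UNIV :: 'a::alg_closed_field set)"
proof
  assume fin: "finite (UNIV :: 'a set)"
  define p :: "'a poly" where "p = (\<Prod>a\<in>UNIV. [:- a, 1:])"
  have "degree p = card (UNIV :: 'a set)"
    unfolding p_def by (subst degree_prod_eq_sum_degree) auto
  then have "degree (p + 1) > 0"
    using fin by (simp add: degree_add_eq_left card_gt_0_iff)
  then obtain x where "poly (p + 1) x = 0"
    using alg_closed_imp_poly_has_root by blast
  moreover have "poly p x = 0"
    using fin by (auto simp: p_def poly_prod)
  ultimately show False by simp
qed

text \<open>
  A polynomial function restricted to an affine line is a polynomial in the parameter of the line.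
\<close>

lemma coord_ring_on_line:
  assumes "f \<in> coord_ring m"
  shows "\<exists>p. \<forall>s. f (\<lambda>k. D k + smult_mat s (N k)) = poly p s"
  using assms
proof induction
  case (const c)
  then show ?case by (intro exI[of _ "[:c:]"]) simp
next
  case (coord k i j)
  then show ?case by (intro exI[of _ "[:D k $ i $ j, N k $ i $ j:]"]) (simp add: generic_mat_def)
next
  case (add f g)
  then obtain p q where "\<forall>s. f (\<lambda>k. D k + smult_mat s (N k)) = poly p s"
    "\<forall>s. g (\<lambda>k. D k + smult_mat s (N k)) = poly q s" by blast
  then show ?case by (intro exI[of _ "p + q"]) simp
next
  case (mult f g)
  then obtain p q where "\<forall>s. f (\<lambda>k. D k + smult_mat s (N k)) = poly p s"
    "\<forall>s. g (\<lambda>k. D k + smult_mat s (N k)) = poly q s" by blast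
  then show ?case by (intro exI[of _ "p * q"]) simp
qed

text \<open>
  Invariants do not see degenerations: along the line, an invariant is a polynomial in \<open>s\<close> that is constant
  for \<open>s \<noteq> 0\<close>, hence constant.
\<close>

lemma inseparable_limit:
  fixes A D N :: "nat \<Rightarrow> 'a::alg_closed_field^2^2"
  assumes "\<And>s. s \<noteq> 0 \<Longrightarrow> inseparable m A (\<lambda>k. D k + smult_mat s (N k))"
  shows "inseparable m A D"
  unfolding inseparable_def
proof
  fix f :: "(nat \<Rightarrow> 'a^2^2) \<Rightarrow> 'a" assume f: "f \<in> invariant_ring m"
  then obtain p where p: "f (\<lambda>k. D k + smult_mat s (N k)) = poly p s" for s
    using coord_ring_on_line[of f m D N] by (auto simp: invariant_ring_def)
  have "UNIV - {0} \<subseteq> {s. poly (p - [:f A:]) s = 0}"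
  proof
    fix s :: 'a assume "s \<in> UNIV - {0}"
    then have "f A = f (\<lambda>k. D k + smult_mat s (N k))"
      using assms[of s] f by (simp add: inseparable_def)
    then show "s \<in> {s. poly (p - [:f A:]) s = 0}" by (simp add: p)
  qed
  moreover have "infinite (UNIV - {0::'a})"
    by (simp add: infinite_UNIV_alg_closed)
  ultimately have "infinite {s. poly (p - [:f A:]) s = 0}"
    by (rule infinite_super)
  then have "p - [:f A:] = 0" using poly_roots_finite by blast
  then have "f A = f (\<lambda>k. D k + smult_mat 0 (N k))" by (simp add: p)
  also have "(\<lambda>k. D k + smult_mat 0 (N k)) = D" by (simp add: fun_eq_iff mat2_eq_iff)
  finally show "f A = f D" .
qed

lemma sqrt_exists: "\<exists>t. t * t = (s::'a::alg_closed_field)"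
  using nth_root_exists[of 2 s] by (simp add: power2_eq_square)

text \<open>
  Conjugation by \<open>diag(t, 1/t)\<close> multiplies the upper right entry by \<open>t\<^sup>2\<close> and divides the lower left one by it. On a
  triangular tuple, \<open>t\<close> or \<open>1/t\<close> can go to 0; as every \<open>s\<close> is a square, the family is a line in \<open>s = t\<^sup>2\<close>.
\<close>

lemma inseparable_diagonal_part:
  fixes A :: "nat \<Rightarrow> 'a::alg_closed_field^2^2"
  assumes "(\<forall>k\<in>{1..m}. A k $ 2 $ 1 = 0) \<or> (\<forall>k\<in>{1..m}. A k $ 1 $ 2 = 0)"
  shows "inseparable m A (\<lambda>k. mat2 (A k $ 1 $ 1) 0 0 (A k $ 2 $ 2))"
proof (rule inseparable_limit)
  fix s :: 'a assume "s \<noteq> 0"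
  obtain t where t: "t * t = s" using sqrt_exists by blast
  with \<open>s \<noteq> 0\<close> have [simp]: "t \<noteq> 0" by auto
  show "inseparable m A (\<lambda>k. mat2 (A k $ 1 $ 1) 0 0 (A k $ 2 $ 2) +
      smult_mat s (mat2 0 (A k $ 1 $ 2) (A k $ 2 $ 1) 0))"
    using assms
  proof
    assume "\<forall>k\<in>{1..m}. A k $ 2 $ 1 = 0"
    then show ?thesis
      by (intro inseparable_act[of "mat2 t 0 0 (1 / t)" "mat2 (1 / t) 0 0 t"])
        (auto simp: det_2 mat2_eq_iff mat2_mult_nth t[symmetric] algebra_simps)
  next
    assume "\<forall>k\<in>{1..m}. A k $ 1 $ 2 = 0"
    then show ?thesis
      by (intro inseparable_act[of "mat2 (1 / t) 0 0 t" "mat2 t 0 0 (1 / t)"])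
        (auto simp: det_2 mat2_eq_iff mat2_mult_nth t[symmetric] algebra_simps)
  qed
qed

text \<open>
  If all components have zero second row, multiplication by \<open>diag(s, 1/s)\<close> from the left scales them by \<open>s\<close>;
  if all have zero second column, multiplication from the right does.
\<close>

lemma inseparable_zero:
  fixes A :: "nat \<Rightarrow> 'a::alg_closed_field^2^2"
  assumes "(\<forall>k\<in>{1..m}. A k $ 2 $ 1 = 0 \<and> A k $ 2 $ 2 = 0) \<or>
    (\<forall>k\<in>{1..m}. A k $ 1 $ 2 = 0 \<and> A k $ 2 $ 2 = 0)"
  shows "inseparable m A (\<lambda>k. 0)"
proof (rule inseparable_limit)
  fix s :: 'a assume s: "s \<noteq> 0"
  show "inseparable m A (\<lambda>k. 0 + smult_mat s (A k))"
    using assms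
  proof
    assume "\<forall>k\<in>{1..m}. A k $ 2 $ 1 = 0 \<and> A k $ 2 $ 2 = 0"
    then show ?thesis
      by (intro inseparable_act[of "mat2 s 0 0 (1 / s)" "mat 1"])
        (auto simp: s det_2 mat2_eq_iff mat2_mult_nth)
  next
    assume "\<forall>k\<in>{1..m}. A k $ 1 $ 2 = 0 \<and> A k $ 2 $ 2 = 0"
    then show ?thesis
      by (intro inseparable_act[of "mat 1" "mat2 s 0 0 (1 / s)"])
        (auto simp: s det_2 mat2_eq_iff mat2_mult_nth)
  qed
qed

section \<open>The values that the system determines\<close>

definition data_agree :: "nat \<Rightarrow> (nat \<Rightarrow> 'a::field^2^2) \<Rightarrow> (nat \<Rightarrow> 'a^2^2) \<Rightarrow> bool" where
  "data_agree m A B \<longleftrightarrow>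
     (\<forall>i\<in>{1..m}. det (A i) = det (B i)) \<and>
     (\<forall>i\<in>{1..m}. \<forall>j\<in>{1..m}. bracket (A i) (A j) = bracket (B i) (B j)) \<and>
     (\<forall>i\<in>{1..m}. \<forall>j\<in>{1..m}. \<forall>k\<in>{1..m}. \<forall>l\<in>{1..m}.
        clifford_trace (A i) (A j) (A k) (A l) = clifford_trace (B i) (B j) (B k) (B l))"

lemma data_agree_sym: "data_agree m A B \<Longrightarrow> data_agree m B A"
  by (simp add: data_agree_def)

lemma data_agree_trans: "data_agree m A B \<Longrightarrow> data_agree m B C \<Longrightarrow> data_agree m A C"
  by (simp add: data_agree_def)

lemma inseparable_imp_data_agree:
  assumes "inseparable m A B"
  shows "data_agree m A B"
proof -
  have agree: "f A = f B" if "f \<in> invariant_ring m" for f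
    using assms that by (simp add: inseparable_def)
  show ?thesis
    unfolding data_agree_def
  proof (intro conjI ballI)
    fix i j k l assume ijkl: "i \<in> {1..m}" "j \<in> {1..m}" "k \<in> {1..m}" "l \<in> {1..m}"
    show "clifford_trace (A i) (A j) (A k) (A l) = clifford_trace (B i) (B j) (B k) (B l)"
      using agree[OF generic_mat_in_invariant_ring(3)[OF ijkl]] unfolding generic_values .
  next
    fix i j assume ij: "i \<in> {1..m}" "j \<in> {1..m}"
    show "bracket (A i) (A j) = bracket (B i) (B j)"
      using agree[OF generic_mat_in_invariant_ring(2)[OF ij ij]] unfolding generic_values .
  next
    fix i assume i: "i \<in> {1..m}"
    show "det (A i) = det (B i)"
      using agree[OF generic_mat_in_invariant_ring(1)[OF i i i i]] unfolding generic_values .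
  qed
qed

text \<open>
  Sorting by exchanges of neighbours: a property of quadruples that is stable under such exchanges holds
  everywhere once it holds for increasing quadruples and for those with two equal neighbours.
\<close>

lemma all_tuples_from_increasing:
  fixes P :: "'i::linorder \<Rightarrow> 'i \<Rightarrow> 'i \<Rightarrow> 'i \<Rightarrow> bool"
  assumes incr: "\<And>i j k l. {i, j, k, l} \<subseteq> I \<Longrightarrow> i < j \<Longrightarrow> j < k \<Longrightarrow> k < l \<Longrightarrow> P i j k l"
    and rep: "\<And>i j k. {i, j, k} \<subseteq> I \<Longrightarrow> P i i j k \<and> P i j j k \<and> P i j k k"
    and swap: "\<And>i j k l. {i, j, k, l} \<subseteq> I \<Longrightarrow> P i j k l \<Longrightarrow> P j i k l \<and> P i k j l \<and> P i j l k"
    and "{i, j, k, l} \<subseteq> I"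
  shows "P i j k l"
proof -
  have increasing: "P i j k l" if "{i, j, k, l} \<subseteq> I" "i \<le> j" "j \<le> k" "k \<le> l" for i j k l
    using incr[of i j k l] rep[of i k l] rep[of i j l] rep[of i j k] that
    by (cases "i = j"; cases "j = k"; cases "k = l") auto
  have s12: "P i j k l" if "P j i k l" "{i, j, k, l} \<subseteq> I" for i j k l
    using swap[of j i k l] that by (simp add: insert_commute)
  have s23: "P i j k l" if "P i k j l" "{i, j, k, l} \<subseteq> I" for i j k l
    using swap[of i k j l] that by (simp add: insert_commute)
  have s34: "P i j k l" if "P i j l k" "{i, j, k, l} \<subseteq> I" for i j k l
    using swap[of i j l k] that by (simp add: insert_commute)
  have insert_last: "P i j k l" if I: "{i, j, k, l} \<subseteq> I" and "i \<le> j" "j \<le> k" for i j k l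
  proof -
    consider "k \<le> l" | "l \<le> k" "j \<le> l" | "l \<le> j" "i \<le> l" | "l \<le> i" by fastforce
    then show ?thesis
    proof cases
      case 1
      show ?thesis by (rule increasing) (use that 1 in simp_all)
    next
      case 2
      show ?thesis by (rule s34, rule increasing) (use that 2 in simp_all)
    next
      case 3
      show ?thesis by (rule s34, rule s23, rule increasing) (use that 3 in simp_all)
    next
      case 4
      show ?thesis by (rule s34, rule s23, rule s12, rule increasing) (use that 4 in simp_all)
    qed
  qed
  have insert_third: "P i j k l" if I: "{i, j, k, l} \<subseteq> I" and "i \<le> j" for i j k l
  proof -
    consider "j \<le> k" | "k \<le> j" "i \<le> k" | "k \<le> i" by fastforce
    then show ?thesis
    proof cases
      case 1
      show ?thesis by (rule insert_last) (use that 1 in simp_all)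
    next
      case 2
      show ?thesis by (rule s23, rule insert_last) (use that 2 in simp_all)
    next
      case 3
      show ?thesis by (rule s23, rule s12, rule insert_last) (use that 3 in simp_all)
    qed
  qed
  show ?thesis
  proof (cases "i \<le> j")
    case True
    show ?thesis by (rule insert_third) (use assms(4) True in simp_all)
  next
    case False
    show ?thesis by (rule s12, rule insert_third) (use assms(4) False in simp_all)
  qed
qed

lemma S_system_members:
  "i \<in> {1..m} \<Longrightarrow> det (generic_mat i) \<in> S_system m"
  "i \<in> {1..m} \<Longrightarrow> j \<in> {1..m} \<Longrightarrow> i < j \<Longrightarrow>
    bracket (generic_mat i) (generic_mat j) \<in> S_system m"
  "{i, j, k, l} \<subseteq> {1..m} \<Longrightarrow> i < j \<Longrightarrow> j < k \<Longrightarrow> k < l \<Longrightarrow>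
    xi2 (generic_mat i) (generic_mat j) (generic_mat k) (generic_mat l) \<in> S_system m"
  unfolding S_system_def atLeastAtMost_iff insert_subset by blast+

text \<open>
  The Clifford relations supply the exchange and repetition hypotheses of the sorting principle
  \<open>all_tuples_from_increasing\<close> for the property that the traces of \<open>A\<close> and \<open>B\<close> agree.
\<close>

lemma data_agree_if_S_system_agrees:
  fixes A B :: "nat \<Rightarrow> 'a::field^2^2"
  assumes "\<And>h. h \<in> S_system m \<Longrightarrow> h A = h B"
  shows "data_agree m A B"
proof -
  have d: "det (A i) = det (B i)" if "i \<in> {1..m}" for i
    using assms[OF S_system_members(1)[OF that]] unfolding generic_values .
  have b_less: "bracket (A i) (A j) = bracket (B i) (B j)" if "i \<in> {1..m}" "j \<in> {1..m}" "i < j" for i j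
    using assms[OF S_system_members(2)[OF that]] unfolding generic_values .
  have b: "bracket (A i) (A j) = bracket (B i) (B j)" if "i \<in> {1..m}" "j \<in> {1..m}" for i j
    using b_less[of i j] b_less[of j i] d[of i] that
    by (cases i j rule: linorder_cases) (simp_all add: bracket_commute bracket_self)
  have "clifford_trace (A i) (A j) (A k) (A l) = clifford_trace (B i) (B j) (B k) (B l)"
    if I: "{i, j, k, l} \<subseteq> {1..m}" for i j k l
    using _ _ _ I
  proof (rule all_tuples_from_increasing)
    fix i j k l assume I: "{i, j, k, l} \<subseteq> {1..m}"
    show "clifford_trace (A j) (A i) (A k) (A l) = clifford_trace (B j) (B i) (B k) (B l) \<and>
      clifford_trace (A i) (A k) (A j) (A l) = clifford_trace (B i) (B k) (B j) (B l) \<and>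
      clifford_trace (A i) (A j) (A l) (A k) = clifford_trace (B i) (B j) (B l) (B k)"
      if "clifford_trace (A i) (A j) (A k) (A l) = clifford_trace (B i) (B j) (B k) (B l)"
    proof -
      have "i \<in> {1..m}" "j \<in> {1..m}" "k \<in> {1..m}" "l \<in> {1..m}" using I by simp_all
      then show ?thesis
        using that
        by (simp only: b clifford_trace_swap(1)[of "A j" "A i"] clifford_trace_swap(1)[of "B j" "B i"]
            clifford_trace_swap(2)[of "A i" "A k" "A j"] clifford_trace_swap(2)[of "B i" "B k" "B j"]
            clifford_trace_swap(3)[of "A i" "A j" "A l"] clifford_trace_swap(3)[of "B i" "B j" "B l"])
    qed
    assume less: "i < j" "j < k" "k < l"
    have x: "xi2 (A i) (A j) (A k) (A l) = xi2 (B i) (B j) (B k) (B l)"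
      using assms[OF S_system_members(3)[OF I less]] unfolding generic_values .
    then have "clifford_trace (A i) (A l) (A j) (A k) = clifford_trace (B i) (B l) (B j) (B k)"
      by (simp add: xi2_eq_clifford_trace)
    moreover have "i \<in> {1..m}" "j \<in> {1..m}" "k \<in> {1..m}" "l \<in> {1..m}" using I by simp_all
    \<comment> \<open>The trace in \<^const>\<open>xi2\<close> has the order \<open>i, l, j, k\<close>; two exchanges restore the increasing order.\<close>
    moreover have "clifford_trace (C i) (C j) (C k) (C l) = bracket (C l) (C k) * bracket (C i) (C j) -
        (bracket (C l) (C j) * bracket (C i) (C k) - clifford_trace (C i) (C l) (C j) (C k))"
      for C :: "nat \<Rightarrow> 'a^2^2"
      unfolding clifford_trace_swap(3)[of "C i" "C j" "C k" "C l"]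
        clifford_trace_swap(2)[of "C i" "C j" "C l" "C k"] ..
    ultimately show "clifford_trace (A i) (A j) (A k) (A l) = clifford_trace (B i) (B j) (B k) (B l)"
      by (simp only: b)
  qed (simp add: clifford_trace_repeat b d)
  then show ?thesis using d b by (simp add: data_agree_def)
qed

section \<open>Linear combinations of the components\<close>

definition lincomb :: "nat set \<Rightarrow> (nat \<Rightarrow> 'r) \<Rightarrow> (nat \<Rightarrow> 'r^2^2) \<Rightarrow> 'r::comm_ring_1^2^2" where
  "lincomb I x A = (\<Sum>k\<in>I. smult_mat (x k) (A k))"

lemma bracket_linear_right:
  "bracket a (b + c) = bracket a b + bracket a c" "bracket a (smult_mat r b) = r * bracket a b"
  "bracket a 0 = 0"
  by (simp_all add: bracket_eq algebra_simps)

lemma bracket_lincomb_right: "bracket a (lincomb I x A) = (\<Sum>k\<in>I. x k * bracket a (A k))"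
  unfolding lincomb_def by (induction I rule: infinite_finite_induct) (simp_all add: bracket_linear_right)

lemma clifford_trace_linear:
  "clifford_trace a (b + b') c d = clifford_trace a b c d + clifford_trace a b' c d"
  "clifford_trace a (smult_mat r b) c d = r * clifford_trace a b c d"
  "clifford_trace a 0 c d = 0"
  "clifford_trace a b c (d + d') = clifford_trace a b c d + clifford_trace a b c d'"
  "clifford_trace a b c (smult_mat r d) = r * clifford_trace a b c d"
  "clifford_trace a b c 0 = 0"
  by (simp_all add: clifford_trace_expand algebra_simps)

lemma clifford_trace_lincomb_left:
  "clifford_trace a (lincomb I x A) c d = (\<Sum>k\<in>I. x k * clifford_trace a (A k) c d)"
  unfolding lincomb_def by (induction I rule: infinite_finite_induct) (simp_all add: clifford_trace_linear)

lemma clifford_trace_lincomb_right: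
  "clifford_trace a b c (lincomb I x A) = (\<Sum>k\<in>I. x k * clifford_trace a b c (A k))"
  unfolding lincomb_def by (induction I rule: infinite_finite_induct) (simp_all add: clifford_trace_linear)

lemma lincomb_act: "lincomb I x (\<lambda>k. g ** A k ** h) = g ** lincomb I x A ** h"
proof -
  have "g ** (P + Q) ** h = g ** P ** h + g ** Q ** h"
    "smult_mat r (g ** P ** h) = g ** smult_mat r P ** h" "g ** 0 ** h = 0" for P Q r
    by (simp_all add: mat2_eq_iff mat2_mult_nth algebra_simps)
  then show ?thesis
    unfolding lincomb_def by (induction I rule: infinite_finite_induct) simp_all
qed

lemma lincomb_smult: "lincomb I (\<lambda>k. r * x k) A = smult_mat r (lincomb I x A)"
  unfolding lincomb_def
  by (induction I rule: infinite_finite_induct) (simp_all add: mat2_eq_iff algebra_simps)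

lemma lincomb_unit_diff:
  assumes "finite I" "i \<in> I"
  shows "lincomb I (\<lambda>k. (if k = i then 1 else 0) - r * x k) A = A i - smult_mat r (lincomb I x A)"
proof -
  have "(\<Sum>k\<in>I. ((if k = i then 1 else 0) - r * x k) * A k $ p $ q) =
      A i $ p $ q - r * (\<Sum>k\<in>I. x k * A k $ p $ q)" for p q
    using assms by (simp add: left_diff_distrib sum_subtractf sum_distrib_left mult.assoc
        if_distrib[of "\<lambda>z. z * _"] sum.delta cong: if_cong)
  then show ?thesis by (simp add: lincomb_def mat2_eq_iff)
qed

lemma det_smult_mat: "det (smult_mat r A) = r * r * det A"
  by (simp add: det_2 algebra_simps)

text \<open>
  The bracket of two combinations is bilinear in the data. In characteristic 2 the determinant is not a
  function of the bracket, so it is built up one summand at a time.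
\<close>

lemma data_agree_lincomb:
  assumes "data_agree m A B"
  shows "bracket (lincomb {1..m} x A) (lincomb {1..m} y A) =
      bracket (lincomb {1..m} x B) (lincomb {1..m} y B)"
    and "det (lincomb {1..m} x A) = det (lincomb {1..m} x B)"
proof -
  have b: "bracket (A i) (A j) = bracket (B i) (B j)" if "i \<in> {1..m}" "j \<in> {1..m}" for i j
    using assms that by (simp add: data_agree_def)
  have left: "bracket (lincomb F x A) (A j) = bracket (lincomb F x B) (B j)"
    if "F \<subseteq> {1..m}" "j \<in> {1..m}" for F j
  proof -
    have "bracket (A j) (lincomb F x A) = bracket (B j) (lincomb F x B)"
      unfolding bracket_lincomb_right using that b by (intro sum.cong) auto
    then show ?thesis by (simp add: bracket_commute)
  qed
  show "bracket (lincomb {1..m} x A) (lincomb {1..m} y A) =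
      bracket (lincomb {1..m} x B) (lincomb {1..m} y B)"
    unfolding bracket_lincomb_right[where x = y] by (intro sum.cong) (simp_all add: left)
  have "det (lincomb F x A) = det (lincomb F x B)" if "F \<subseteq> {1..m}" for F
    using finite_subset[OF that finite_atLeastAtMost] that
  proof (induction F rule: finite_induct)
    case empty
    then show ?case by (simp add: lincomb_def det_2)
  next
    case (insert i F)
    have "lincomb (insert i F) x C = lincomb F x C + smult_mat (x i) (C i)" for C :: "nat \<Rightarrow> 'a^2^2"
      using insert by (simp add: lincomb_def add.commute)
    moreover have "det (A i) = det (B i)"
      using assms insert.prems by (simp add: data_agree_def)
    ultimately show ?case
      using insert left[of F i] by (simp add: det_add2 bracket_linear_right det_smult_mat)
  qed
  then show "det (lincomb {1..m} x A) = det (lincomb {1..m} x B)" by simp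
qed

section \<open>Normal forms of singular matrices\<close>

text \<open>
  \<open>SL\<^sub>2\<close> acts transitively on nonzero vectors.
\<close>

lemma move_vector:
  fixes u1 u2 :: "'a::field"
  assumes "u1 \<noteq> 0 \<or> u2 \<noteq> 0"
  shows "\<exists>g :: 'a^2^2. det g = 1 \<and> g$1$1 * u1 + g$1$2 * u2 = 1 \<and> g$2$1 * u1 + g$2$2 * u2 = 0"
proof (cases "u1 = 0")
  case True
  with assms show ?thesis by (intro exI[of _ "mat2 0 (1 / u2) (- u2) 0"]) (simp add: det_2)
next
  case False
  then show ?thesis by (intro exI[of _ "mat2 (1 / u1) 0 (- u2) u1"]) (simp add: det_2)
qed

lemma rank_one_factorization:
  fixes U :: "'a::field^2^2"
  assumes "det U = 0" "U \<noteq> 0"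
  obtains u1 u2 v1 v2 where "u1 \<noteq> 0 \<or> u2 \<noteq> 0" "v1 \<noteq> 0 \<or> v2 \<noteq> 0"
    "U = mat2 (u1 * v1) (u1 * v2) (u2 * v1) (u2 * v2)"
proof -
  have d: "U$1$1 * U$2$2 = U$1$2 * U$2$1" using assms by (simp add: det_2)
  consider "U$1$1 \<noteq> 0" | "U$1$1 = 0" "U$1$2 \<noteq> 0" | "U$1$1 = 0" "U$1$2 = 0" by blast
  then show thesis
  proof cases
    case 1
    moreover from 1 d have "U$2$2 = U$2$1 / U$1$1 * U$1$2" by (simp add: field_simps)
    ultimately show thesis
      by (intro that[of 1 "U$2$1 / U$1$1" "U$1$1" "U$1$2"]) (simp_all add: mat2_eq_iff)
  next
    case 2
    moreover from 2 d have "U$2$1 = 0" by simp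
    ultimately show thesis
      by (intro that[of 1 "U$2$2 / U$1$2" 0 "U$1$2"]) (simp_all add: mat2_eq_iff)
  next
    case 3
    with assms(2) have "U$2$1 \<noteq> 0 \<or> U$2$2 \<noteq> 0" by (auto simp: mat2_eq_iff)
    with 3 show thesis
      by (intro that[of 0 1 "U$2$1" "U$2$2"]) (simp_all add: mat2_eq_iff)
  qed
qed

text \<open>
  A nonzero singular matrix is a product \<open>u v\<^sup>T\<close>; \<open>g\<close> moves \<open>u\<close> and \<open>h\<close> moves \<open>v\<close> to the first basis vector.
\<close>

lemma move_singular:
  fixes U :: "'a::field^2^2"
  assumes "det U = 0" "U \<noteq> 0"
  obtains g h where "det g = 1" "det h = 1" "g ** U ** h = mat2 1 0 0 0"
proof -
  obtain u1 u2 v1 v2 where nz: "u1 \<noteq> 0 \<or> u2 \<noteq> 0" "v1 \<noteq> 0 \<or> v2 \<noteq> 0"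
    and U: "U = mat2 (u1 * v1) (u1 * v2) (u2 * v1) (u2 * v2)"
    by (rule rank_one_factorization[OF assms])
  obtain g :: "'a^2^2" where g: "det g = 1" "g$1$1 * u1 + g$1$2 * u2 = 1" "g$2$1 * u1 + g$2$2 * u2 = 0"
    using move_vector[OF nz(1)] by blast
  obtain h :: "'a^2^2" where h: "det h = 1" "h$1$1 * v1 + h$1$2 * v2 = 1" "h$2$1 * v1 + h$2$2 * v2 = 0"
    using move_vector[OF nz(2)] by blast
  have "(g ** U ** transpose h) $ i $ j =
      (g$i$1 * u1 + g$i$2 * u2) * (h$j$1 * v1 + h$j$2 * v2)" for i j
    by (simp add: U mat2_mult_nth transpose_def algebra_simps)
  then have "g ** U ** transpose h = mat2 1 0 0 0"
    by (simp add: mat2_eq_iff g h)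
  then show thesis using that[of g "transpose h"] g h by (simp add: det_transpose)
qed

text \<open>
  Once \<open>X\<close> is the first matrix unit, the bracket with \<open>X\<close> reads off the lower right entry, so that the second
  matrix has the form \<open>(bc, b; c, 1)\<close>. Unipotent matrices, which fix the first matrix unit, clear \<open>b\<close> and \<open>c\<close>.
\<close>

lemma move_hyperbolic_pair:
  fixes X Y :: "'a::field^2^2"
  assumes "det X = 0" "det Y = 0" "bracket X Y = 1"
  obtains g h where "det g = 1" "det h = 1"
    "g ** X ** h = mat2 1 0 0 0" "g ** Y ** h = mat2 0 0 0 1"
proof -
  have "X \<noteq> 0" using assms by (auto simp: bracket_eq)
  then obtain g h where gh: "det g = 1" "det h = 1" and X: "g ** X ** h = mat2 1 0 0 0"
    using move_singular assms(1) by blast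
  define Z where "Z = g ** Y ** h"
  have "bracket (mat2 1 0 0 0) Z = 1"
    unfolding Z_def X[symmetric] using bracket_invariant gh assms by metis
  then have Z22: "Z$2$2 = 1" by (simp add: bracket_eq)
  have "det Z = 0" using gh assms by (simp add: Z_def det_mul)
  then have Z11: "Z$1$1 = Z$1$2 * Z$2$1" by (simp add: det_2 Z22)
  define p where "p = mat2 1 (- Z$1$2) 0 1"
  define r where "r = mat2 1 0 (- Z$2$1) 1"
  have "det (p ** g) = 1" "det (h ** r) = 1"
    unfolding det_mul gh by (simp_all add: p_def r_def det_2)
  moreover have "p ** g ** X ** (h ** r) = p ** mat2 1 0 0 0 ** r"
    by (simp add: matrix_mul_assoc flip: X)
  then have "p ** g ** X ** (h ** r) = mat2 1 0 0 0"
    by (simp add: p_def r_def mat2_eq_iff mat2_mult_nth)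
  moreover have "p ** g ** Y ** (h ** r) = p ** Z ** r"
    by (simp add: matrix_mul_assoc Z_def)
  then have "p ** g ** Y ** (h ** r) = mat2 0 0 0 1"
    by (simp add: p_def r_def mat2_eq_iff mat2_mult_nth Z11 Z22)
  ultimately show thesis by (rule that)
qed

section \<open>Separation\<close>

(* The index sets are written {1..m}; keeping 1 intact lets facts about lincomb {1..m} rewrite. *)
declare One_nat_def [simp del]

text \<open>
  With one nonzero component moved to the first matrix unit, orthogonality to it kills all lower right
  entries. Singularity and orthogonality of the others then say that the upper right entries or the lower
  left entries all vanish: the two families of maximal totally singular subspaces, each of which
  a torus contracts to 0.
\<close>

lemma inseparable_totally_singular:
  fixes A :: "nat \<Rightarrow> 'a::alg_closed_field^2^2"
  assumes sing: "\<And>k. k \<in> {1..m} \<Longrightarrow> det (A k) = 0"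
    and orth: "\<And>k l. k \<in> {1..m} \<Longrightarrow> l \<in> {1..m} \<Longrightarrow> bracket (A k) (A l) = 0"
  shows "inseparable m A (\<lambda>k. 0)"
proof (cases "\<forall>k\<in>{1..m}. A k = 0")
  case True
  then show ?thesis by (intro inseparable_cong) simp
next
  case False
  then obtain l where l: "l \<in> {1..m}" "A l \<noteq> 0" by blast
  obtain g h where gh: "det g = 1" "det h = 1" and Al: "g ** A l ** h = mat2 1 0 0 0"
    using move_singular[OF sing[OF l(1)] l(2)] by blast
  define A' where "A' k = g ** A k ** h" for k
  have "bracket (A' k) (A' i) = 0" "det (A' k) = 0" if "k \<in> {1..m}" "i \<in> {1..m}" for k i
    using that sing orth gh by (simp_all add: A'_def bracket_invariant det_mul)
  note A' = this
  have d: "A' k $ 2 $ 2 = 0" if "k \<in> {1..m}" for k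
    using A'(1)[OF l(1) that] by (simp add: A'_def[of l] Al bracket_eq)
  have bc: "A' k $ 1 $ 2 * A' k $ 2 $ 1 = 0" if "k \<in> {1..m}" for k
    using A'(2)[OF that that] by (simp add: det_2 d[OF that])
  have cross: "A' k $ 1 $ 2 * A' i $ 2 $ 1 + A' i $ 1 $ 2 * A' k $ 2 $ 1 = 0"
    if "k \<in> {1..m}" "i \<in> {1..m}" for k i
  proof -
    have "bracket (A' k) (A' i) = - (A' k $ 1 $ 2 * A' i $ 2 $ 1 + A' i $ 1 $ 2 * A' k $ 2 $ 1)"
      using that by (simp add: bracket_eq d)
    then show ?thesis using A'(1)[OF that] by (metis neg_equal_0_iff_equal)
  qed
  have "(\<forall>k\<in>{1..m}. A' k $ 2 $ 1 = 0) \<or> (\<forall>k\<in>{1..m}. A' k $ 1 $ 2 = 0)"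
  proof (rule disjCI, rule ballI)
    fix k assume k: "k \<in> {1..m}" and "\<not> (\<forall>k\<in>{1..m}. A' k $ 1 $ 2 = 0)"
    then obtain i where i: "i \<in> {1..m}" "A' i $ 1 $ 2 \<noteq> 0" by blast
    then have "A' i $ 2 $ 1 = 0" using bc by fastforce
    then show "A' k $ 2 $ 1 = 0" using cross[OF k i(1)] i by simp
  qed
  then have "inseparable m A' (\<lambda>k. 0)"
    by (intro inseparable_zero) (use d in blast)
  moreover have "inseparable m A A'"
    using gh by (rule inseparable_act) (simp add: A'_def)
  ultimately show ?thesis by (blast intro: inseparable_trans)
qed

text \<open>
  With one nonzero \<open>U\<^sub>l\<close> moved to the matrix unit \<open>E\<^sub>1\<^sub>2\<close>, the orthogonality relations force \<open>X\<close> to be upper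
  triangular and all \<open>U\<^sub>k\<close> to be multiples of \<open>E\<^sub>1\<^sub>2\<close>. The diagonal part of the tuple consists of the multiples
  \<open>c\<^sub>k\<close> of a single diagonal matrix of determinant 1, which the group moves to the identity.
\<close>

lemma inseparable_scalar_part:
  fixes A U :: "nat \<Rightarrow> 'a::alg_closed_field^2^2"
  assumes X: "det X = 1"
    and A: "\<And>k. k \<in> {1..m} \<Longrightarrow> A k = smult_mat (c k) X + U k"
    and sing: "\<And>k. k \<in> {1..m} \<Longrightarrow> det (U k) = 0"
    and orth: "\<And>k l. k \<in> {1..m} \<Longrightarrow> l \<in> {1..m} \<Longrightarrow> bracket (U k) (U l) = 0"
    and orthX: "\<And>k. k \<in> {1..m} \<Longrightarrow> bracket X (U k) = 0"
  shows "inseparable m A (\<lambda>k. mat2 (c k) 0 0 (c k))"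
proof (cases "\<forall>k\<in>{1..m}. U k = 0")
  case True
  have "adj2 X ** smult_mat r X = mat2 r 0 0 r" for r
  proof -
    have "adj2 X ** smult_mat r X = smult_mat r (adj2 X ** X)"
      by (simp add: mat2_eq_iff mat2_mult_nth algebra_simps)
    then show ?thesis by (simp add: mult_adj2(2)[OF X] mat2_eq_iff)
  qed
  then show ?thesis
    by (intro inseparable_act[of "adj2 X" "mat 1"]) (simp_all add: X A True)
next
  case False
  then obtain l where l: "l \<in> {1..m}" "U l \<noteq> 0" by blast
  obtain g h0 where g: "det g = 1" "det h0 = 1" "g ** U l ** h0 = mat2 1 0 0 0"
    using move_singular[OF sing[OF l(1)] l(2)] by blast
  \<comment> \<open>The second factor turns the first matrix unit into \<open>E\<^sub>1\<^sub>2\<close>.\<close>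
  define h where "h = h0 ** mat2 0 1 (- 1) 0"
  have gh: "det g = 1" "det h = 1" unfolding h_def det_mul g by (simp_all add: det_2)
  have Ul: "g ** U l ** h = mat2 0 1 0 0"
    unfolding h_def matrix_mul_assoc g(3) by (simp add: mat2_eq_iff mat2_mult_nth)
  define U' where "U' k = g ** U k ** h" for k
  define X' where "X' = g ** X ** h"
  have "bracket (U' k) (U' i) = 0" "det (U' k) = 0" "bracket X' (U' k) = 0"
    if "k \<in> {1..m}" "i \<in> {1..m}" for k i
    using that sing orth orthX gh by (simp_all add: U'_def X'_def bracket_invariant det_mul)
  note U' = this
  have X'21: "X' $ 2 $ 1 = 0"
    using U'(3)[OF l(1) l(1)] by (simp add: U'_def Ul bracket_eq)
  have "det X' = 1" using X gh by (simp add: X'_def det_mul)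
  then have pq: "X' $ 1 $ 1 * X' $ 2 $ 2 = 1" by (simp add: det_2 X'21)
  have c0: "U' k $ 2 $ 1 = 0" if "k \<in> {1..m}" for k
    using U'(1)[OF l(1) that] by (simp add: U'_def[of l] Ul bracket_eq)
  have ad: "U' k $ 1 $ 1 = 0 \<and> U' k $ 2 $ 2 = 0" if k: "k \<in> {1..m}" for k
  proof -
    have "U' k $ 1 $ 1 * U' k $ 2 $ 2 = 0"
      using U'(2)[OF k k] by (simp add: det_2 c0[OF k])
    moreover have "X' $ 1 $ 1 * U' k $ 2 $ 2 + U' k $ 1 $ 1 * X' $ 2 $ 2 = 0"
      using U'(3)[OF k k] by (simp add: bracket_eq c0[OF k] X'21)
    ultimately show ?thesis using pq by auto
  qed
  define A' where "A' k = g ** A k ** h" for k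
  have A': "A' k = smult_mat (c k) X' + U' k" if "k \<in> {1..m}" for k
    by (simp add: A'_def A[OF that] X'_def U'_def mat2_eq_iff mat2_mult_nth algebra_simps)
  have "inseparable m A A'"
    using gh by (rule inseparable_act) (simp add: A'_def)
  also have "inseparable m A' (\<lambda>k. mat2 (A' k $ 1 $ 1) 0 0 (A' k $ 2 $ 2))"
    by (rule inseparable_diagonal_part) (simp add: A' c0 X'21)
  also have "inseparable m \<dots> (\<lambda>k. mat2 (c k) 0 0 (c k))"
    by (rule inseparable_act[of "mat2 (X' $ 2 $ 2) 0 0 (X' $ 1 $ 1)" "mat 1"])
      (use pq in \<open>simp_all add: det_2 mat2_eq_iff mat2_mult_nth A' ad algebra_simps\<close>)
  finally show ?thesis .
qed

text \<open>
  Relative to a hyperbolic pair, \<open>E\<^sub>1\<^sub>1\<^sup>* = E\<^sub>2\<^sub>2\<close> and \<open>E\<^sub>2\<^sub>2\<^sup>* = E\<^sub>1\<^sub>1\<close>, so brackets and traces with the pair give the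
  diagonal entries and the products \<open>b\<^sub>i c\<^sub>j\<close> of the off-diagonal entries. These products form a matrix of
  rank at most one, which determines \<open>b\<close> and \<open>c\<close> up to \<open>(t b, c / t)\<close> when it is nonzero.
\<close>

lemma inseparable_if_same_hyperbolic_frame:
  fixes A B :: "nat \<Rightarrow> 'a::alg_closed_field^2^2"
  assumes agree: "data_agree m A B"
    and A: "lincomb {1..m} x A = mat2 1 0 0 0" "lincomb {1..m} y A = mat2 0 0 0 1"
    and B: "lincomb {1..m} x B = mat2 1 0 0 0" "lincomb {1..m} y B = mat2 0 0 0 1"
  shows "inseparable m A B"
proof -
  have "bracket (A k) (lincomb {1..m} z A) = bracket (B k) (lincomb {1..m} z B)"
    if "k \<in> {1..m}" for k z
    unfolding bracket_lincomb_right using agree that by (intro sum.cong) (simp_all add: data_agree_def)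
  from this[of _ y] this[of _ x]
  have diag: "A k $ 1 $ 1 = B k $ 1 $ 1" "A k $ 2 $ 2 = B k $ 2 $ 2" if "k \<in> {1..m}" for k
    using that by (simp_all add: A B bracket_eq)
  have "clifford_trace (A i) (lincomb {1..m} x A) (A j) (lincomb {1..m} y A) =
      clifford_trace (B i) (lincomb {1..m} x B) (B j) (lincomb {1..m} y B)"
    if "i \<in> {1..m}" "j \<in> {1..m}" for i j
    unfolding clifford_trace_lincomb_left clifford_trace_lincomb_right
    using agree that by (intro sum.cong arg_cong2[of _ _ _ _ "(*)"]) (simp_all add: data_agree_def)
  then have prod: "A i $ 1 $ 2 * A j $ 2 $ 1 = B i $ 1 $ 2 * B j $ 2 $ 1"
    if "i \<in> {1..m}" "j \<in> {1..m}" for i j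
    using that by (simp add: A B clifford_trace_expand)
  show ?thesis
  proof (cases "\<exists>i\<in>{1..m}. \<exists>j\<in>{1..m}. A i $ 1 $ 2 * A j $ 2 $ 1 \<noteq> 0")
    case True
    then obtain i j where ij: "i \<in> {1..m}" "j \<in> {1..m}" and nz: "A i $ 1 $ 2 * A j $ 2 $ 1 \<noteq> 0"
      by blast
    then have nzB: "B i $ 1 $ 2 \<noteq> 0" "B j $ 2 $ 1 \<noteq> 0" and nzA: "A i $ 1 $ 2 \<noteq> 0"
      using prod[OF ij] by auto
    \<comment> \<open>Conjugation by \<open>diag(r, 1/r)\<close> acts on the upper right entries through the square of \<open>r\<close>.\<close>
    obtain r where r: "r * r = B i $ 1 $ 2 / A i $ 1 $ 2" using sqrt_exists by blast
    then have [simp]: "r \<noteq> 0" using nzA nzB by auto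
    have c: "B k $ 2 $ 1 = A k $ 2 $ 1 / (r * r)" if "k \<in> {1..m}" for k
      using prod[OF ij(1) that] nzA nzB by (simp add: r field_simps)
    have b: "B k $ 1 $ 2 = r * r * A k $ 1 $ 2" if "k \<in> {1..m}" for k
    proof -
      have "A k $ 1 $ 2 * A j $ 2 $ 1 = B k $ 1 $ 2 * (A j $ 2 $ 1 / (r * r))"
        using prod[OF that ij(2)] c[OF ij(2)] by simp
      then show ?thesis using nz by (simp add: field_simps)
    qed
    show ?thesis
      by (rule inseparable_act[of "mat2 r 0 0 (1 / r)" "mat2 (1 / r) 0 0 r"])
        (auto simp: det_2 mat2_eq_iff mat2_mult_nth b c diag)
  next
    case False
    have diagonal: "inseparable m C (\<lambda>k. mat2 (C k $ 1 $ 1) 0 0 (C k $ 2 $ 2))"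
      if "\<And>i j. i \<in> {1..m} \<Longrightarrow> j \<in> {1..m} \<Longrightarrow> C i $ 1 $ 2 * C j $ 2 $ 1 = 0"
      for C :: "nat \<Rightarrow> 'a^2^2"
      by (rule inseparable_diagonal_part) (use that in \<open>metis mult_eq_0_iff\<close>)
    have "inseparable m A (\<lambda>k. mat2 (A k $ 1 $ 1) 0 0 (A k $ 2 $ 2))"
      using False by (intro diagonal) blast
    also have "inseparable m \<dots> (\<lambda>k. mat2 (B k $ 1 $ 1) 0 0 (B k $ 2 $ 2))"
      by (rule inseparable_cong) (simp add: diag)
    also have "inseparable m \<dots> B"
      using False prod by (intro inseparable_sym[OF diagonal]) metis
    finally show ?thesis .
  qed
qed

lemma hyperbolic_normalisation:
  fixes A :: "nat \<Rightarrow> 'a::field^2^2"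
  assumes "det (lincomb {1..m} x A) = 0" "det (lincomb {1..m} y A) = 0"
    and "bracket (lincomb {1..m} x A) (lincomb {1..m} y A) = 1"
  obtains A' where "inseparable m A A'"
    "lincomb {1..m} x A' = mat2 1 0 0 0" "lincomb {1..m} y A' = mat2 0 0 0 1"
proof -
  obtain g h where gh: "det g = 1" "det h = 1"
    and "g ** lincomb {1..m} x A ** h = mat2 1 0 0 0" "g ** lincomb {1..m} y A ** h = mat2 0 0 0 1"
    using move_hyperbolic_pair[OF assms] by blast
  moreover have "inseparable m A (\<lambda>k. g ** A k ** h)"
    using gh by (rule inseparable_act) simp
  ultimately show thesis using that[of "\<lambda>k. g ** A k ** h"] by (simp add: lincomb_act)
qed

lemma inseparable_if_hyperbolic:
  fixes A B :: "nat \<Rightarrow> 'a::alg_closed_field^2^2"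
  assumes agree: "data_agree m A B"
    and sing: "det (lincomb {1..m} x A) = 0" "det (lincomb {1..m} y A) = 0"
    and nz: "bracket (lincomb {1..m} x A) (lincomb {1..m} y A) \<noteq> 0"
  shows "inseparable m A B"
proof -
  define r where "r = 1 / bracket (lincomb {1..m} x A) (lincomb {1..m} y A)"
  define y' where "y' = (\<lambda>k. r * y k)"
  note y' = lincomb_smult[of "{1..m}" r y, folded y'_def]
  have frameA: "det (lincomb {1..m} x A) = 0" "det (lincomb {1..m} y' A) = 0"
    "bracket (lincomb {1..m} x A) (lincomb {1..m} y' A) = 1"
    using nz by (simp_all add: y' sing det_smult_mat bracket_linear_right r_def)
  then have frameB: "det (lincomb {1..m} x B) = 0" "det (lincomb {1..m} y' B) = 0"
    "bracket (lincomb {1..m} x B) (lincomb {1..m} y' B) = 1"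
    using data_agree_lincomb[OF agree] by simp_all
  obtain A' where A': "inseparable m A A'"
    "lincomb {1..m} x A' = mat2 1 0 0 0" "lincomb {1..m} y' A' = mat2 0 0 0 1"
    by (rule hyperbolic_normalisation[OF frameA])
  obtain B' where B': "inseparable m B B'"
    "lincomb {1..m} x B' = mat2 1 0 0 0" "lincomb {1..m} y' B' = mat2 0 0 0 1"
    by (rule hyperbolic_normalisation[OF frameB])
  have "data_agree m A' B'"
    using agree A'(1) B'(1) by (meson data_agree_sym data_agree_trans inseparable_imp_data_agree)
  then have "inseparable m A' B'"
    using A' B' by (intro inseparable_if_same_hyperbolic_frame)
  then show ?thesis using A'(1) B'(1) by (blast intro: inseparable_trans inseparable_sym)
qed

lemma quadratic_root:
  fixes b c :: "'a::alg_closed_field"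
  obtains r r' where "r + r' = b" "r * r' = c"
proof -
  obtain r where "poly [:c, - b, 1:] r = 0"
    using alg_closed_imp_poly_has_root[of "[:c, - b, 1:]"] by auto
  then have "r * (b - r) = c" by (simp add: algebra_simps)
  then show thesis using that[of r "b - r"] by simp
qed

text \<open>
  The case distinction on the span of the \<open>A\<^sub>k\<close>. Its hypotheses, and the relations used in each case, are
  statements about determinants and brackets of combinations, so they pass from \<open>A\<close> to \<open>B\<close>.
\<close>

lemma inseparable_if_data_agree:
  fixes A B :: "nat \<Rightarrow> 'a::alg_closed_field^2^2"
  assumes agree: "data_agree m A B"
  shows "inseparable m A B"
proof (cases "\<exists>x y. det (lincomb {1..m} x A) = 0 \<and> det (lincomb {1..m} y A) = 0 \<and>
    bracket (lincomb {1..m} x A) (lincomb {1..m} y A) \<noteq> 0")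
  case True
  then show ?thesis using inseparable_if_hyperbolic[OF agree] by blast
next
  case False
  let ?L = "lincomb {1..m}"
  from False have orth: "bracket (?L x A) (?L y A) = 0"
    if "det (?L x A) = 0" "det (?L y A) = 0" for x y using that by blast
  have transfer: "det (?L x B) = det (?L x A)" "bracket (?L x B) (?L y B) = bracket (?L x A) (?L y A)"
    for x y using data_agree_lincomb[OF agree] by simp_all
  \<comment> \<open>The coefficients of the combination \<open>A\<^sub>i - r X\<close>, where \<open>X\<close> has the coefficients \<open>x\<close>.\<close>
  define e where "e x i r = (\<lambda>k. (if k = i then 1 else 0) - r * x k)"
    for x :: "nat \<Rightarrow> 'a" and i :: nat and r
  have e: "?L (e x i r) C = C i - smult_mat r (?L x C)" if "i \<in> {1..m}" for x i r and C :: "nat \<Rightarrow> 'a^2^2"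
    using lincomb_unit_diff[of "{1..m}" i r x C] that by (simp add: e_def)
  show ?thesis
  proof (cases "\<forall>x. det (?L x A) = 0")
    case True
    have "inseparable m C (\<lambda>k. 0)"
      if C: "\<And>x. det (?L x C) = 0" "\<And>x y. bracket (?L x C) (?L y C) = 0"
      for C :: "nat \<Rightarrow> 'a^2^2"
    proof -
      have C_eq: "C i = ?L (e (\<lambda>_. 0) i 0) C" if "i \<in> {1..m}" for i
        using e[OF that, of "\<lambda>_. 0" 0 C] by (simp add: mat2_eq_iff)
      show ?thesis
      proof (rule inseparable_totally_singular)
        show "det (C k) = 0" if "k \<in> {1..m}" for k
          using C(1) C_eq[OF that] by metis
        show "bracket (C k) (C l) = 0" if "k \<in> {1..m}" "l \<in> {1..m}" for k l
          using C(2) C_eq[OF that(1)] C_eq[OF that(2)] by metis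
      qed
    qed
    from this[of A] this[of B] have "inseparable m A (\<lambda>k. 0)" "inseparable m B (\<lambda>k. 0)"
      using True orth transfer by simp_all
    then show ?thesis by (blast intro: inseparable_trans inseparable_sym)
  next
    case False
    then obtain x0 where x0: "det (?L x0 A) \<noteq> 0" by blast
    obtain t where t: "t * t = 1 / det (?L x0 A)" using sqrt_exists by blast
    define x where "x = (\<lambda>k. t * x0 k)"
    have X: "det (?L x A) = 1"
      using x0 by (simp add: x_def lincomb_smult det_smult_mat t)
    have "\<exists>r. det (?L (e x i r) A) = 0 \<and> bracket (?L x A) (?L (e x i r) A) = 0"
      if i: "i \<in> {1..m}" for i
    proof -
      obtain r r' where r: "r + r' = bracket (?L x A) (A i)" "r * r' = det (A i)"
        by (rule quadratic_root)
      have det_e: "det (?L (e x i s) A) = det (A i) - s * bracket (?L x A) (A i) + s * s" for s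
      proof -
        have "det (A i - smult_mat s P) = det (A i) - s * bracket P (A i) + s * s * det P" for P
          by (simp add: det_2 bracket_eq algebra_simps)
        then show ?thesis by (simp add: e[OF i] X)
      qed
      have bracket_e: "bracket (?L x A) (?L (e x i s) A) = bracket (?L x A) (A i) - 2 * s" for s
      proof -
        have "bracket P (A i - smult_mat s P) = bracket P (A i) - 2 * (s * det P)" for P
          by (simp add: det_2 bracket_eq algebra_simps)
        then show ?thesis by (simp add: e[OF i] X)
      qed
      have sing: "det (?L (e x i r) A) = 0" "det (?L (e x i r') A) = 0"
        unfolding det_e r[symmetric] by (simp_all add: algebra_simps)
      \<comment> \<open>Both roots give singular matrices, so their bracket vanishes; but it equals minus the square of \<open>r - r'\<close>.\<close>
      have "0 = bracket (?L (e x i r) A) (?L (e x i r') A)" using orth[OF sing] ..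
      also have "?L (e x i r') A = ?L (e x i r) A + smult_mat (r - r') (?L x A)"
        by (simp add: e[OF i] mat2_eq_iff algebra_simps)
      also have "bracket (?L (e x i r) A) \<dots> = (r - r') * bracket (?L x A) (?L (e x i r) A)"
        by (simp add: bracket_linear_right bracket_self sing bracket_commute)
      also have "\<dots> = - ((r - r') * (r - r'))"
        unfolding bracket_e r[symmetric] by (simp add: algebra_simps)
      finally have "r = r'" by simp
      then show ?thesis using sing bracket_e[of r] r by (intro exI[of _ r]) simp
    qed
    then obtain c where c: "\<And>i. i \<in> {1..m} \<Longrightarrow> det (?L (e x i (c i)) A) = 0"
      "\<And>i. i \<in> {1..m} \<Longrightarrow> bracket (?L x A) (?L (e x i (c i)) A) = 0" by metis
    have "inseparable m C (\<lambda>k. mat2 (c k) 0 0 (c k))"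
      if C: "\<And>x. det (?L x C) = det (?L x A)"
        "\<And>x y. bracket (?L x C) (?L y C) = bracket (?L x A) (?L y A)"
      for C :: "nat \<Rightarrow> 'a^2^2"
    proof (rule inseparable_scalar_part)
      show "det (?L x C) = 1" by (simp add: C X)
      show "C k = smult_mat (c k) (?L x C) + ?L (e x k (c k)) C" if "k \<in> {1..m}" for k
        by (simp add: e[OF that])
      show "det (?L (e x k (c k)) C) = 0" if "k \<in> {1..m}" for k
        using that by (simp add: C c)
      show "bracket (?L (e x k (c k)) C) (?L (e x l (c l)) C) = 0"
        if "k \<in> {1..m}" "l \<in> {1..m}" for k l
        using that by (simp add: C c orth)
      show "bracket (?L x C) (?L (e x k (c k)) C) = 0" if "k \<in> {1..m}" for k
        using that by (simp add: C c)
    qed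
    from this[of A] this[of B]
    have "inseparable m A (\<lambda>k. mat2 (c k) 0 0 (c k))" "inseparable m B (\<lambda>k. mat2 (c k) 0 0 (c k))"
      using transfer by simp_all
    then show ?thesis by (blast intro: inseparable_trans inseparable_sym)
  qed
qed

section \<open>Irredundance\<close>

lemma S_system_cases:
  assumes "h \<in> S_system m"
  obtains (det) i where "i \<in> {1..m}" "h = det (generic_mat i)"
  | (bracket) i j where "i \<in> {1..m}" "j \<in> {1..m}" "i < j"
      "h = bracket (generic_mat i) (generic_mat j)"
  | (xi2) i j k l where "{i, j, k, l} \<subseteq> {1..m}" "i < j" "j < k" "k < l"
      "h = xi2 (generic_mat i) (generic_mat j) (generic_mat k) (generic_mat l)"
  using assms unfolding S_system_def
proof (elim UnE CollectE exE conjE)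
  fix i assume "h = det (generic_mat i)" "1 \<le> i" "i \<le> m"
  then show thesis by (intro det[of i]) simp_all
next
  fix i j assume "h = bracket (generic_mat i) (generic_mat j)" "1 \<le> i" "i < j" "j \<le> m"
  then show thesis by (intro bracket[of i j]) simp_all
next
  fix i j k l
  assume "h = xi2 (generic_mat i) (generic_mat j) (generic_mat k) (generic_mat l)"
    "1 \<le> i" "i < j" "j < k" "k < l" "l \<le> m"
  then show thesis by (intro xi2[of i j k l]) simp_all
qed

lemma S_system_subset_invariant_ring: "S_system m \<subseteq> invariant_ring m"
proof
  fix h :: "(nat \<Rightarrow> 'a::field^2^2) \<Rightarrow> 'a"
  assume "h \<in> S_system m"
  then show "h \<in> invariant_ring m"
  proof (cases rule: S_system_cases)
    case (det i)
    show ?thesis unfolding det(2) by (rule generic_mat_in_invariant_ring(1)) (rule det(1))+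
  next
    case (bracket i j)
    show ?thesis unfolding bracket(4) by (rule generic_mat_in_invariant_ring(2)) (rule bracket(1,2))+
  next
    case (xi2 i j k l)
    show ?thesis unfolding xi2(5) by (rule generic_mat_in_invariant_ring(4)) (use xi2(1) in simp_all)
  qed
qed

text \<open>
  A pair of tuples that only \<open>s\<close> distinguishes is a witness against the smaller system, because \<open>s\<close>
  itself is an invariant.
\<close>

lemma not_separating_without:
  fixes s :: "(nat \<Rightarrow> 'a::field^2^2) \<Rightarrow> 'a"
  assumes s: "s \<in> S_system m" "s A \<noteq> s B"
    and agree: "\<And>h. h \<in> S_system m \<Longrightarrow> h \<noteq> s \<Longrightarrow> h A = h B"
  shows "\<not> separating m (S_system m - {s})"
proof
  assume sep: "separating m (S_system m - {s})"
  let ?r = "\<lambda>C. restrict C {1..m}"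
  have r: "h (?r C) = h C" if "h \<in> S_system m" for h :: "(nat \<Rightarrow> 'a^2^2) \<Rightarrow> 'a" and C
    using that S_system_subset_invariant_ring[of m]
    by (intro coord_ring_cong[of _ m]) (auto simp: invariant_ring_def)
  have "s \<in> invariant_ring m" using s(1) S_system_subset_invariant_ring by blast
  moreover have "s (?r A) \<noteq> s (?r B)" by (simp only: r s not_False_eq_True)
  moreover have "?r A \<in> mat_tuples m" "?r B \<in> mat_tuples m" by (simp_all add: mat_tuples_def)
  ultimately obtain h where "h \<in> S_system m - {s}" "h (?r A) \<noteq> h (?r B)"
    using sep unfolding separating_def by metis
  then show False using agree[of h] by (simp only: r Diff_iff singleton_iff) blast
qed

lemma bracket_zero: "bracket 0 b = 0" "bracket a 0 = 0"
  by (simp_all add: bracket_eq)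

lemma xi2_zero: "y1 = 0 \<or> y2 = 0 \<or> y3 = 0 \<or> y4 = 0 \<Longrightarrow> xi2 y1 y2 y3 y4 = 0"
  by (auto simp: xi2_eq_clifford_trace clifford_trace_expand)

text \<open>
  An increasing quadruple is determined by its set of entries, so a different one has an entry outside.
\<close>

lemma increasing_eq_if_subset:
  fixes i j k l :: "'i::linorder"
  assumes "i < j" "j < k" "k < l" "p < q" "q < r" "r < s"
    and "{p, q, r, s} \<subseteq> {i, j, k, l}"
  shows "p = i \<and> q = j \<and> r = k \<and> s = l"
proof -
  have sorted: "sorted_wrt (<) [i, j, k, l]" "sorted_wrt (<) [p, q, r, s]"
    using assms(1-6) by auto
  then have "distinct [i, j, k, l]" "distinct [p, q, r, s]"
    by (simp_all only: strict_sorted_iff)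
  then have "card (set [p, q, r, s]) = card (set [i, j, k, l])"
    by (simp only: distinct_card) simp
  then have "set [p, q, r, s] = set [i, j, k, l]"
    using assms(7) by (intro card_subset_eq) simp_all
  then have "[p, q, r, s] = [i, j, k, l]"
    using sorted by (intro strict_sorted_equal)
  then show ?thesis by simp
qed

lemma S_system_irredundant: "irredundant m (S_system m :: ((nat \<Rightarrow> 'a::field^2^2) \<Rightarrow> 'a) set)"
  unfolding irredundant_def
proof
  fix s :: "(nat \<Rightarrow> 'a^2^2) \<Rightarrow> 'a"
  assume s: "s \<in> S_system m"
  then show "\<not> separating m (S_system m - {s})"
  proof (cases rule: S_system_cases)
    case (det i)
    define A :: "nat \<Rightarrow> 'a^2^2" where "A k = (if k = i then mat 1 else 0)" for k
    show ?thesis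
    proof (rule not_separating_without[OF s])
      show "s A \<noteq> s (\<lambda>_. 0)"
        unfolding det generic_values by (simp add: A_def det_2)
    next
      fix h :: "(nat \<Rightarrow> 'a^2^2) \<Rightarrow> 'a" assume "h \<in> S_system m" and "h \<noteq> s"
      then show "h A = h (\<lambda>_. 0)"
      proof (cases rule: S_system_cases)
        case (det k)
        then have "k \<noteq> i" using \<open>h \<noteq> s\<close> \<open>s = _\<close> by blast
        then show ?thesis unfolding det(2) generic_values by (simp add: A_def)
      next
        case (bracket k l)
        then have "A k = 0 \<or> A l = 0" by (auto simp: A_def)
        then show ?thesis unfolding bracket(4) generic_values by (auto simp: bracket_zero)
      next
        case (xi2 k1 k2 k3 k4)
        then have "A k1 = 0 \<or> A k2 = 0" by (auto simp: A_def)
        then show ?thesis unfolding xi2(5) generic_values using xi2_zero by (metis (no_types))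
      qed
    qed
  next
    case (bracket i j)
    define A :: "nat \<Rightarrow> 'a^2^2" where
      "A k = (if k = i then mat2 1 0 0 0 else if k = j then mat2 0 0 0 1 else 0)" for k
    show ?thesis
    proof (rule not_separating_without[OF s])
      show "s A \<noteq> s (\<lambda>_. 0)"
        unfolding bracket(4) generic_values using bracket(3) by (simp add: A_def bracket_eq)
    next
      fix h :: "(nat \<Rightarrow> 'a^2^2) \<Rightarrow> 'a" assume "h \<in> S_system m" and "h \<noteq> s"
      then show "h A = h (\<lambda>_. 0)"
      proof (cases rule: S_system_cases)
        case (det k)
        show ?thesis unfolding det generic_values by (simp add: A_def det_2)
      next
        case (bracket k l)
        then have "\<not> (k = i \<and> l = j)" using \<open>h \<noteq> s\<close> \<open>s = _\<close> by blast
        then have "A k = 0 \<or> A l = 0" 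
          using \<open>i < j\<close> \<open>k < l\<close> by (auto simp: A_def)
        then show ?thesis unfolding bracket(4) generic_values by (auto simp: bracket_zero)
      next
        case (xi2 k1 k2 k3 k4)
        then have "A k1 = 0 \<or> A k2 = 0 \<or> A k3 = 0" by (auto simp: A_def)
        then show ?thesis unfolding xi2(5) generic_values using xi2_zero by (metis (no_types))
      qed
    qed
  next
    case (xi2 i j k l)
    \<comment> \<open>The matrix units have vanishing determinants, and transposition exchanges the last two, preserving all brackets while changing the trace from 1 to 0.\<close>
    define A :: "nat \<Rightarrow> 'a^2^2" where
      "A p = (if p = i then mat2 1 0 0 0 else if p = j then mat2 0 0 0 1
        else if p = k then mat2 0 0 1 0 else if p = l then mat2 0 1 0 0 else 0)" for p
    show ?thesis
    proof (rule not_separating_without[OF s])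
      show "s A \<noteq> s (\<lambda>p. transpose (A p))"
        unfolding xi2(5) generic_values xi2_eq_clifford_trace
        using xi2(2-4) by (simp add: clifford_trace_expand A_def transpose_def)
    next
      fix h :: "(nat \<Rightarrow> 'a^2^2) \<Rightarrow> 'a" assume "h \<in> S_system m" and "h \<noteq> s"
      then show "h A = h (\<lambda>p. transpose (A p))"
      proof (cases rule: S_system_cases)
        case (det p)
        show ?thesis unfolding det generic_values by (simp add: det_transpose)
      next
        case (bracket p q)
        show ?thesis unfolding bracket(4) generic_values by (simp add: bracket_eq transpose_def)
      next
        case (xi2 p q r t)
        then have "\<not> {p, q, r, t} \<subseteq> {i, j, k, l}"
          using increasing_eq_if_subset[OF \<open>i < j\<close> \<open>j < k\<close> \<open>k < l\<close> \<open>p < q\<close> \<open>q < r\<close> \<open>r < t\<close>]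
            \<open>h \<noteq> s\<close> \<open>s = _\<close> by blast
        moreover have "A n = 0" if "n \<notin> {i, j, k, l}" for n
          using that by (simp add: A_def)
        ultimately have zero: "A p = 0 \<or> A q = 0 \<or> A r = 0 \<or> A t = 0" by blast
        have "transpose (0 :: 'a^2^2) = 0" by (simp add: transpose_def mat2_eq_iff)
        with zero have "xi2 (A p) (A q) (A r) (A t) = 0"
          "xi2 (transpose (A p)) (transpose (A q)) (transpose (A r)) (transpose (A t)) = 0"
          by (auto intro!: xi2_zero)
        then show ?thesis unfolding xi2(5) generic_values by simp
      qed
    qed
  qed
qed

theorem theorem6p1:
  fixes m :: nat
  assumes "1 \<le> m"
  shows "separating m (S_system m :: ((nat \<Rightarrow> 'a::alg_closed_field^2^2) \<Rightarrow> 'a) set)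
       \<and> irredundant m (S_system m :: ((nat \<Rightarrow> 'a::alg_closed_field^2^2) \<Rightarrow> 'a) set)"
proof
  have "inseparable m A B" if "\<forall>h\<in>S_system m. h A = h B" for A B :: "nat \<Rightarrow> 'a^2^2"
    using that by (intro inseparable_if_data_agree data_agree_if_S_system_agrees) blast
  then show "separating m (S_system m :: ((nat \<Rightarrow> 'a^2^2) \<Rightarrow> 'a) set)"
    unfolding separating_def inseparable_def using S_system_subset_invariant_ring by blast
  show "irredundant m (S_system m :: ((nat \<Rightarrow> 'a^2^2) \<Rightarrow> 'a) set)"
    by (rule S_system_irredundant)
qed

end
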